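(* Let $f:D\subset\mathbb R^k\to\mathbb C$ be a measurable function with $0<\mu_k(D)<\infty$, let $\{X_n\}_n$ be a sequence of normal matrices $X_n\in\mathbb C^{n\times n}$ such that $\{X_n\}_n\sim_\lambda f$, and let $\{Y_n\}_n$ be a sequence of matrices $Y_n\in\mathbb C^{n\times n}$. Suppose that one of the following conditions is met (as $n\to\infty$, with the convention $1/\infty=0$). 1. $\|Y_n\|_p=o(1)$ for some $1\le p\le 2$. 2. $\|Y_n\|_p=o(n^{2/p-1})$ for some $2\le p\le\infty$. 3. $\{Y_n\}_n$ is zero-distributed and the matrices $X_n+Y_n$ are normal. Then $\{X_n+Y_n\}_n\sim_\lambda f$.
   Context: $\mu_k$ is the Lebesgue measure in $\mathbb R^k$. For $A\in\mathbb C^{n\times n}$ and $1\le p\le\infty$, $\|A\|_p$ is the Schatten $p$-norm, i.e. the $p$-norm of the vector of singular values of $A$; $\|A\|=\|A\|_\infty$ is the spectral norm. Spectral distribution: for a sequence $\{A_n\}_n$ with $A_n\in\mathbb C^{n\times n}$ and a measurable $f:D\subset\mathbb R^k\to\mathbb C$ with $0<\mu_k(D)<\infty$, $\{A_n\}_n\sim_\lambda f$ means $\lim_{n\to\infty}\frac1n\sum_{i=1}^nF(\lambda_i(A_n))=\frac1{\mu_k(D)}\int_DF(f(\mathbf x))\,d\mathbf x$ for all continuous $F:\mathbb C\to\mathbb C$ with bounded support, where $\lambda_i(A_n)$ are the eigenvalues of $A_n$. A sequence $\{Z_n\}_n$ with $Z_n\in\mathbb C^{n\times n}$ is zero-distributed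 if $Z_n=R_n+N_n$ with $\lim_{n\to\infty}n^{-1}\mathrm{rank}(R_n)=\lim_{n\to\infty}\|N_n\|=0$. *)

theory Defs
  imports
    "HOL-Analysis.Analysis"
    "HOL-Library.Landau_Symbols"
    "Jordan_Normal_Form.Schur_Decomposition"
    "Jordan_Normal_Form.DL_Rank"
begin

text \<open>Eigenvalues are counted with algebraic multiplicity, so an \<open>n \<times> n\<close> matrix has exactly \<open>n\<close> of them.\<close>

definition eigenvalue_mset :: "complex mat \<Rightarrow> complex multiset" where
  "eigenvalue_mset A = proots (char_poly A)"

definition normal_mat :: "complex mat \<Rightarrow> bool" where
  "normal_mat A \<longleftrightarrow> A * mat_adjoint A = mat_adjoint A * A"

text \<open>The eigenvalues of \<open>A\<^sup>* A\<close> are real and nonnegative, so \<open>Re\<close> only changes their type.\<close>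

definition singular_value_mset :: "complex mat \<Rightarrow> real multiset" where
  "singular_value_mset A =
     image_mset (\<lambda>z. sqrt (Re z)) (eigenvalue_mset (mat_adjoint A * A))"

text \<open>Inserting \<open>0\<close> under the maximum only matters for the \<open>0 \<times> 0\<close> matrix, whose norm is thus \<open>0\<close>.\<close>

definition schatten_norm :: "ereal \<Rightarrow> complex mat \<Rightarrow> real" where
  "schatten_norm p A =
     (if p = \<infinity> then Max (insert 0 (set_mset (singular_value_mset A)))
      else (\<Sum>s\<in>#singular_value_mset A. s powr real_of_ereal p) powr (1 / real_of_ereal p))"

abbreviation spectral_norm :: "complex mat \<Rightarrow> real" where
  "spectral_norm A \<equiv> schatten_norm \<infinity> A"

text \<open>Only the values of \<open>f\<close> on \<open>D\<close> are relevant.\<close>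

definition spectral_distribution ::
    "(nat \<Rightarrow> complex mat) \<Rightarrow> (real ^ 'k) set \<Rightarrow> (real ^ 'k \<Rightarrow> complex) \<Rightarrow> bool" where
  "spectral_distribution A D f \<longleftrightarrow>
     (\<forall>F :: complex \<Rightarrow> complex.
        continuous_on UNIV F \<and> bounded {z. F z \<noteq> 0} \<longrightarrow>
        (\<lambda>n. (\<Sum>z\<in>#eigenvalue_mset (A n). F z) / of_nat n)
          \<longlonglongrightarrow> integral\<^sup>L (lebesgue_on D) (\<lambda>x. F (f x)) / of_real (measure lebesgue D))"

definition zero_distributed :: "(nat \<Rightarrow> complex mat) \<Rightarrow> bool" where
  "zero_distributed Z \<longleftrightarrow>
     (\<exists>R N :: nat \<Rightarrow> complex mat.
        (\<forall>n. R n \<in> carrier_mat n n \<and> N n \<in> carrier_mat n n \<and> Z n = R n + N n) \<and>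
        (\<lambda>n. real (vec_space.rank n (R n)) / real n) \<longlonglongrightarrow> 0 \<and>
        (\<lambda>n. spectral_norm (N n)) \<longlonglongrightarrow> 0)"

end

theory Submission
  imports Defs
begin

text \<open>
  It suffices to show that the eigenvalue averages of \<open>X\<^sub>n\<close> and \<open>X\<^sub>n + Y\<^sub>n\<close> of every continuous \<open>F\<close>
  with bounded support get arbitrarily close.

  Conditions 1 and 2 both force the Frobenius norm of \<open>Y\<^sub>n\<close> to tend to \<open>0\<close>. Write \<open>v\<^sub>k\<close> for an
  orthonormal eigenbasis of \<open>X\<^sub>n\<close> with eigenvalues \<open>a\<^sub>k\<close>, and \<open>u\<^sub>j\<close> for a Schur basis of \<open>X\<^sub>n + Y\<^sub>n\<close> with
  eigenvalues \<open>b\<^sub>j\<close>. The weights \<open>w\<^sub>k\<^sub>j = \<bar>\<langle>v\<^sub>k, u\<^sub>j\<rangle>\<bar>\<^sup>2\<close> are doubly stochastic, and the sum of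
  \<open>w\<^sub>k\<^sub>j \<bar>a\<^sub>k - b\<^sub>j\<bar>\<^sup>2\<close> is at most \<open>n\<close> times the squared Frobenius norm of \<open>Y\<^sub>n\<close> (a weighted form of a
  theorem of Sun): in a normal matrix the strictly upper part is controlled by the strictly lower
  one, which in the Schur basis comes from \<open>Y\<^sub>n\<close> alone. The double stochasticity replaces the
  matching of eigenvalues that Birkhoff's theorem would provide.

  Under condition 3, a dimension count shows that a disc of radius \<open>s\<close> contains at most \<open>rank R\<^sub>n\<close>
  eigenvalues more of one of the normal matrices \<open>X\<^sub>n\<close>, \<open>X\<^sub>n + Y\<^sub>n\<close> than the concentric disc of radius
  \<open>s + \<parallel>N\<^sub>n\<parallel>\<close> does of the other. Integrating this over all centres against \<open>F \<ge> 0\<close> compares the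
  averages of \<open>F\<close>.
\<close>

unbundle no vec_syntax
unbundle no inner_syntax

hide_const (open) Finite_Cartesian_Product.vec

section \<open>Unitary triangularisation\<close>

lemma mat_adjoint_carrier [simp]:
  "A \<in> carrier_mat m n \<Longrightarrow> mat_adjoint A \<in> carrier_mat n m"
  unfolding mat_adjoint_def carrier_mat_def by simp

lemma mat_adjoint_dim [simp]:
  "dim_row (mat_adjoint A) = dim_col A" "dim_col (mat_adjoint A) = dim_row A"
  unfolding mat_adjoint_def by simp_all

lemma mat_adjoint_index [simp]:
  "i < dim_col A \<Longrightarrow> j < dim_row A \<Longrightarrow> mat_adjoint A $$ (i,j) = cnj (A $$ (j,i))" for A :: "complex mat"
  unfolding mat_adjoint_def by (simp add: mat_of_rows_index)

lemma mat_adjoint_adjoint [simp]: "mat_adjoint (mat_adjoint A) = A" for A :: "complex mat"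
  by (rule eq_matI) auto

lemma mat_adjoint_mult:
  fixes A B :: "complex mat"
  assumes "A \<in> carrier_mat m k" "B \<in> carrier_mat k n"
  shows "mat_adjoint (A * B) = mat_adjoint B * mat_adjoint A"
  using assms by (intro eq_matI) (auto simp: scalar_prod_def mult.commute)

definition is_unitary :: "nat \<Rightarrow> complex mat \<Rightarrow> bool" where
  "is_unitary n U \<longleftrightarrow> U \<in> carrier_mat n n \<and> mat_adjoint U * U = 1\<^sub>m n"

text \<open>A left inverse of a square matrix is also a right inverse, so the one-sided definition
  suffices.\<close>

lemma is_unitaryD:
  assumes "is_unitary n U"
  shows "U \<in> carrier_mat n n" "mat_adjoint U \<in> carrier_mat n n"
    "mat_adjoint U * U = 1\<^sub>m n" "U * mat_adjoint U = 1\<^sub>m n"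
proof -
  show U: "U \<in> carrier_mat n n" and eq: "mat_adjoint U * U = 1\<^sub>m n"
    using assms by (auto simp: is_unitary_def)
  show U': "mat_adjoint U \<in> carrier_mat n n" using U by simp
  show "U * mat_adjoint U = 1\<^sub>m n"
    using mat_mult_left_right_inverse[OF U' U eq] .
qed

lemma is_unitary_adjoint:
  assumes "is_unitary n U"
  shows "is_unitary n (mat_adjoint U)"
  unfolding is_unitary_def using is_unitaryD[OF assms] by simp

lemma is_unitary_mult:
  assumes "is_unitary n U" "is_unitary n V"
  shows "is_unitary n (U * V)"
proof -
  note u = is_unitaryD[OF assms(1)] and v = is_unitaryD[OF assms(2)]
  have "mat_adjoint (U * V) * (U * V) = mat_adjoint V * (mat_adjoint U * (U * V))"
    using u v by (simp add: mat_adjoint_mult[OF u(1) v(1)] assoc_mult_mat[of _ n n _ n _ n])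
  also have "mat_adjoint U * (U * V) = (mat_adjoint U * U) * V"
    by (rule assoc_mult_mat[symmetric, OF u(2,1) v(1)])
  finally show ?thesis
    using u v by (simp add: is_unitary_def)
qed

section \<open>Schur form with a unitary change of basis\<close>

text \<open>Gram-Schmidt on a basis that begins with \<open>v\<close> leaves its first vector
  unchanged; normalising the resulting orthogonal columns makes the matrix unitary and only rescales
  \<open>v\<close>.\<close>

lemma unitary_completion:
  fixes v :: "complex vec"
  assumes v: "v \<in> carrier_vec n" and v0: "v \<noteq> 0\<^sub>v n"
  obtains W c where "is_unitary n W" "col W 0 = c \<cdot>\<^sub>v v"
proof -
  interpret cof_vec_space n "TYPE(complex)" .
  define b where "b = basis_completion v"
  from basis_completion[OF v v0, folded b_def]
  have dist_b: "distinct b" and indep: "\<not> lin_dep (set b)" and b: "set b \<subseteq> carrier_vec n"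
    and hdb: "hd b = v" and len_b: "length b = n" by auto
  have n: "n \<noteq> 0" using v v0 by (metis carrier_vecD eq_vecI not_less_zero zero_carrier_vec)
  from hdb len_b n obtain vs where bv: "b = v # vs" by (cases b, auto)
  define ws where "ws = gram_schmidt n b"
  from gram_schmidt_result[OF b dist_b indep refl, folded ws_def]
  have ws: "set ws \<subseteq> carrier_vec n" "corthogonal ws" "length ws = n"
    by (auto simp: len_b)
  from gram_schmidt_hd[OF v, of vs, folded bv] have hdws: "hd ws = v" unfolding ws_def .
  \<comment> \<open>The reciprocal Euclidean length of \<open>w\<close>, as a complex
    scalar.\<close>
  define d where "d w = complex_of_real (1 / sqrt (Re (w \<bullet>c w)))" for w :: "complex vec"
  define W where "W = mat_of_cols n (map (\<lambda>w. d w \<cdot>\<^sub>v w) ws)"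
  have W: "W \<in> carrier_mat n n" using ws by (auto simp: W_def)
  have wsi: "ws ! i \<in> carrier_vec n" if "i < n" for i using ws that by auto
  have Wij: "W $$ (i,j) = d (ws!j) * (ws ! j $ i)" if "i < n" "j < n" for i j
    using that ws wsi[of j] by (simp add: W_def mat_of_cols_index)
  have "mat_adjoint W * W = 1\<^sub>m n"
  proof (rule eq_matI)
    fix i j assume ij: "i < dim_row (1\<^sub>m n)" "j < dim_col (1\<^sub>m n)"
    hence i: "i < n" and j: "j < n" by auto
    have "(mat_adjoint W * W) $$ (i,j) = (\<Sum>k<n. cnj (W $$ (k,i)) * W $$ (k,j))"
      using W i j by (simp add: scalar_prod_def atLeast0LessThan)
    also have "\<dots> = (\<Sum>k<n. d (ws!i) * d (ws!j) * (ws!j $ k * cnj (ws!i $ k)))"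
      using i j by (intro sum.cong) (auto simp: Wij d_def)
    also have "\<dots> = d (ws!i) * d (ws!j) * (ws!j \<bullet>c ws!i)"
      using wsi[OF i] by (simp add: scalar_prod_def atLeast0LessThan sum_distrib_left)
    also have "\<dots> = 1\<^sub>m n $$ (i,j)"
    proof (cases "i = j")
      case False
      then have "ws!j \<bullet>c ws!i = 0" using corthogonalD[OF ws(2), of j i] i j ws by auto
      then show ?thesis using False i j by simp
    next
      case True
      have ne: "ws!i \<bullet>c ws!i \<noteq> 0" using corthogonalD[OF ws(2), of i i] i ws by auto
      have re: "ws!i \<bullet>c ws!i = complex_of_real (\<Sum>k<n. (cmod (ws!i $ k))\<^sup>2)"
        using wsi[OF i] by (simp add: scalar_prod_def atLeast0LessThan complex_norm_square[symmetric])
      define s where "s = (\<Sum>k<n. (cmod (ws!i $ k))\<^sup>2)"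
      have "s \<ge> 0" unfolding s_def by (intro sum_nonneg) auto
      moreover have "s \<noteq> 0" using ne unfolding re s_def[symmetric] by simp
      ultimately have "d (ws!i) * d (ws!i) * (ws!i \<bullet>c ws!i) = 1"
        unfolding d_def re s_def[symmetric]
        by (simp add: of_real_mult[symmetric] del: of_real_mult)
      then show ?thesis using True i by simp
    qed
    finally show "(mat_adjoint W * W) $$ (i,j) = 1\<^sub>m n $$ (i,j)" .
  qed (use W in auto)
  then have "is_unitary n W" using W by (simp add: is_unitary_def)
  moreover have "col W 0 = d v \<cdot>\<^sub>v v"
  proof -
    have "ws \<noteq> []" using n ws by auto
    then have "ws ! 0 = v" using hdws by (simp add: hd_conv_nth)
    then show ?thesis using n ws v by (simp add: W_def)
  qed
  ultimately show ?thesis by (rule that)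
qed

text \<open>Deflation by induction on \<open>es\<close>: in a unitary basis starting with an
  eigenvector for \<open>e\<close>, the first column is \<open>e\<close> followed by zeros, and the
  trailing block has the remaining factors as its characteristic polynomial.\<close>

lemma unitary_schur_prod_list:
  fixes A :: "complex mat"
  assumes "A \<in> carrier_mat n n" "char_poly A = (\<Prod>e\<leftarrow>es. [:- e, 1:])"
  shows "\<exists>U T. is_unitary n U \<and> T \<in> carrier_mat n n \<and> upper_triangular T \<and> diag_mat T = es
    \<and> A * U = U * T"
  using assms
proof (induct es arbitrary: n A)
  case Nil
  with degree_monic_char_poly[of A n] have "n = 0" by simp
  then show ?case
    using Nil by (intro exI[of _ A]) (auto simp: is_unitary_def diag_mat_def)
next
  case (Cons e es n A)
  have A: "A \<in> carrier_mat n n" by fact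
  let ?n1 = "n - 1"
  have cp: "char_poly A = [: -e, 1 :] * (\<Prod>e \<leftarrow> es. [:- e, 1:])" using Cons(3) by simp
  have mon: "monic (\<Prod>e\<leftarrow> es. [:- e, 1:])" by (rule monic_prod_list, auto)
  have deg: "degree (char_poly A) = Suc (degree (\<Prod>e\<leftarrow> es. [:- e, 1:]))" unfolding cp
    by (subst degree_mult_eq, insert mon, auto)
  with degree_monic_char_poly[OF A] have n: "n \<noteq> 0" by auto
  have "eigenvalue A e"
    unfolding eigenvalue_root_char_poly[OF A] cp by simp
  then obtain v where v: "v \<in> carrier_vec n" "v \<noteq> 0\<^sub>v n" "A *\<^sub>v v = e \<cdot>\<^sub>v v"
    using A unfolding eigenvalue_def eigenvector_def by auto
  obtain W c where W: "is_unitary n W" and W0: "col W 0 = c \<cdot>\<^sub>v v"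
    using unitary_completion[OF v(1,2)] .
  note w = is_unitaryD[OF W]
  define A' where "A' = mat_adjoint W * A * W"
  have A': "A' \<in> carrier_mat n n" using w A unfolding A'_def by (metis mult_carrier_mat)
  have WA': "W * A' = A * W"
  proof -
    have "W * A' = W * (mat_adjoint W * (A * W))"
      using A w unfolding A'_def by (subst assoc_mult_mat[of _ n n _ n _ n]) auto
    also have "\<dots> = (W * mat_adjoint W) * (A * W)"
      using A w by (subst assoc_mult_mat[of _ n n _ n _ n]) auto
    finally show ?thesis using A w by simp
  qed
  have col0: "col A' 0 = e \<cdot>\<^sub>v col (1\<^sub>m n) 0"
  proof -
    have "A' = mat_adjoint W * (A * W)"
      using A w unfolding A'_def by (subst assoc_mult_mat[of _ n n _ n _ n]) auto
    then have "col A' 0 = mat_adjoint W *\<^sub>v col (A * W) 0"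
      using n A w(1) by auto
    also have "col (A * W) 0 = A *\<^sub>v col W 0"
      using n A w(1) by auto
    also have "\<dots> = e \<cdot>\<^sub>v col W 0"
      unfolding W0 using A v by (simp add: mult_mat_vec[of _ n n] smult_smult_assoc mult.commute)
    also have "mat_adjoint W *\<^sub>v \<dots> = e \<cdot>\<^sub>v (mat_adjoint W *\<^sub>v col W 0)"
      using w by (intro mult_mat_vec[of _ n n]) auto
    also have "mat_adjoint W *\<^sub>v col W 0 = col (mat_adjoint W * W) 0"
      using n w by (intro col_mult2[symmetric, of _ n n _ n]) auto
    finally show ?thesis using w(3) by simp
  qed
  obtain A1 A2 A0 A3 where splitA': "split_block A' 1 1 = (A1,A2,A0,A3)"
    by (cases "split_block A' 1 1", auto)
  from A' n have "dim_row A' = 1 + ?n1" "dim_col A' = 1 + ?n1" by auto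
  from split_block[OF splitA' this] have A2: "A2 \<in> carrier_mat 1 ?n1"
    and A3: "A3 \<in> carrier_mat ?n1 ?n1"
    and A'block: "A' = four_block_mat A1 A2 A0 A3" by auto
  have A'i0: "A' $$ (i, 0) = (if i = 0 then e else 0)" if "i < n" for i
    using arg_cong[OF col0, of "\<lambda>v. v $ i"] A' n that by auto
  have A1id: "A1 = mat 1 1 (\<lambda> _. e)"
    using splitA'[unfolded split_block_def Let_def] A'i0 A' n
    by (auto simp: col_def)
  have A1: "A1 \<in> carrier_mat 1 1" unfolding A1id by auto
  have A0id: "A0 = 0\<^sub>m ?n1 1"
    using splitA'[unfolded split_block_def Let_def] A'i0 A' by auto
  have A0: "A0 \<in> carrier_mat ?n1 1" unfolding A0id by auto
  have "similar_mat A' A"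
    unfolding similar_mat_def similar_mat_wit_def Let_def
    using A' A w by (intro exI[of _ "mat_adjoint W"] exI[of _ W]) (auto simp: A'_def)
  from char_poly_similar[OF this] cp
  have cp': "char_poly A' = [: -e,1 :] * (\<Prod> e \<leftarrow> es. [:- e, 1:])" by simp
  also have "char_poly A' = char_poly A1 * char_poly A3"
    unfolding A'block A0id
    by (rule char_poly_four_block_zeros_col[OF A1 A2 A3])
  also have "char_poly A1 = [: -e,1 :]"
    by (simp add: A1id char_poly_defs det_def sign_def)
  finally have "char_poly A3 = (\<Prod> e \<leftarrow> es. [:- e, 1:])"
    by (metis mult_cancel_left pCons_eq_0_iff zero_neq_one)
  from Cons(1)[OF A3 this] obtain P T where P: "is_unitary ?n1 P" and T: "T \<in> carrier_mat ?n1 ?n1"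
    "upper_triangular T" "diag_mat T = es" and PT: "A3 * P = P * T" by blast
  note p = is_unitaryD[OF P]
  \<comment> \<open>The block matrix \<open>diag(1, P)\<close> triangularises the trailing block and
    keeps the first column of \<open>A'\<close>.\<close>
  define Q where "Q = four_block_mat (1\<^sub>m 1) (0\<^sub>m 1 ?n1) (0\<^sub>m ?n1 1) P"
  define T' where "T' = four_block_mat A1 (A2 * P) (0\<^sub>m ?n1 1) T"
  have n': "1 + ?n1 = n" using n by simp
  have Q: "Q \<in> carrier_mat n n" using p(1) four_block_carrier_mat[of "1\<^sub>m 1" 1 1 P ?n1 ?n1] n' by (auto simp: Q_def)
  have T': "T' \<in> carrier_mat n n" using T(1) A1 four_block_carrier_mat[of A1 1 1 T ?n1 ?n1] n' by (auto simp: T'_def)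
  have adjQ: "mat_adjoint Q = four_block_mat (1\<^sub>m 1) (0\<^sub>m 1 ?n1) (0\<^sub>m ?n1 1) (mat_adjoint P)"
    unfolding Q_def using p(1) by (intro eq_matI) (auto simp: mat_adjoint_index)
  have "mat_adjoint Q * Q = four_block_mat (1\<^sub>m 1) (0\<^sub>m 1 ?n1) (0\<^sub>m ?n1 1) (1\<^sub>m ?n1)"
    unfolding adjQ unfolding Q_def
    using p by (subst mult_four_block_mat[of _ 1 1 _ ?n1 _ ?n1 _ _ 1 _ ?n1]) auto
  also have "\<dots> = 1\<^sub>m n" using n' by (intro eq_matI) auto
  finally have uQ: "is_unitary n Q" using Q by (simp add: is_unitary_def)
  have "A' * Q = Q * T'"
    unfolding A'block A0id Q_def T'_def
    using A1 A2 A3 p T(1) PT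
    by (subst (1 2) mult_four_block_mat[of _ 1 1 _ ?n1 _ ?n1 _ _ 1 _ ?n1]) auto
  have "A * (W * Q) = (W * A') * Q"
    unfolding WA' by (rule assoc_mult_mat[symmetric, OF A w(1) Q])
  also have "\<dots> = W * (A' * Q)"
    by (rule assoc_mult_mat[OF w(1) A' Q])
  also have "\<dots> = (W * Q) * T'"
    unfolding \<open>A' * Q = Q * T'\<close> by (rule assoc_mult_mat[symmetric, OF w(1) Q T'])
  finally have "A * (W * Q) = (W * Q) * T'" .
  moreover have "upper_triangular T'" unfolding T'_def
    by (intro upper_triangular_four_block[OF A1 T(1) _ T(2)]) (auto simp: A1id)
  moreover have "diag_mat T' = e # es"
    using diag_four_block_mat[OF A1 T(1)] T(3) by (auto simp: T'_def A1id diag_mat_def)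
  ultimately show ?case
    using is_unitary_mult[OF W uQ] T' by blast
qed

lemma eigenvalue_mset_prod_list:
  assumes "char_poly A = (\<Prod>e\<leftarrow>es. [:- e, 1:])"
  shows "eigenvalue_mset A = mset es"
proof -
  have "proots (\<Prod>e\<leftarrow>es. [:- e, 1:]) = mset es"
  proof (induct es)
    case (Cons e es)
    have "(\<Prod>e\<leftarrow>es. [:- e, 1:]) \<noteq> 0" by (auto simp: prod_list_zero_iff)
    then show ?case using Cons by (simp add: proots_mult del: mult_pCons_left)
  qed simp
  then show ?thesis using assms by (simp add: eigenvalue_mset_def)
qed

text \<open>Every complex characteristic polynomial splits, so a list \<open>es\<close> exists.
  Indexing the eigenvalues by \<open>[0..<n]\<close> allows sums over the multiset to become sums
  over \<open>i < n\<close>.\<close>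

theorem unitary_schur:
  fixes A :: "complex mat"
  assumes A: "A \<in> carrier_mat n n"
  obtains U T where "is_unitary n U" "T \<in> carrier_mat n n" "upper_triangular T" "A * U = U * T"
    "eigenvalue_mset A = image_mset (\<lambda>i. T $$ (i,i)) (mset [0..<n])"
proof -
  obtain es where es: "char_poly A = (\<Prod>e\<leftarrow>es. [:- e, 1:])"
    using char_poly_factorized[OF A] by blast
  obtain U T where *: "is_unitary n U" "T \<in> carrier_mat n n" "upper_triangular T" "diag_mat T = es"
     "A * U = U * T"
    using unitary_schur_prod_list[OF A es] by blast
  moreover have "eigenvalue_mset A = image_mset (\<lambda>i. T $$ (i,i)) (mset [0..<n])"
    using eigenvalue_mset_prod_list[OF es] *(2,4) by (auto simp: diag_mat_def)
  ultimately show ?thesis using that by blast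
qed

section \<open>Frobenius norm and normal matrices\<close>

text \<open>The Euclidean norm; going through \<open>L2_set\<close> supplies its triangle
  inequality.\<close>

definition vnorm :: "complex vec \<Rightarrow> real" where
  "vnorm x = L2_set (\<lambda>i. cmod (x $ i)) {..<dim_vec x}"

text \<open>The square of the Frobenius norm.\<close>

definition frob :: "complex mat \<Rightarrow> real" where
  "frob A = (\<Sum>i<dim_row A. \<Sum>j<dim_col A. (cmod (A $$ (i,j)))\<^sup>2)"

lemma of_real_cmod_sq: "(complex_of_real (cmod z))\<^sup>2 = z * cnj z"
  using complex_norm_square[of z] by simp

lemma vnorm_nonneg [simp]: "0 \<le> vnorm x"
  by (simp add: vnorm_def L2_set_nonneg)

lemma vnorm_sq: "(vnorm x)\<^sup>2 = (\<Sum>i<dim_vec x. (cmod (x $ i))\<^sup>2)"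
  by (simp add: vnorm_def L2_set_def sum_nonneg)

lemma vnorm_add_le:
  assumes "x \<in> carrier_vec n" "y \<in> carrier_vec n"
  shows "vnorm (x + y) \<le> vnorm x + vnorm y"
proof -
  have "vnorm (x + y) \<le> L2_set (\<lambda>i. cmod (x $ i) + cmod (y $ i)) {..<n}"
    unfolding vnorm_def using assms by (auto intro!: L2_set_mono norm_triangle_ineq)
  also have "\<dots> \<le> vnorm x + vnorm y"
    unfolding vnorm_def using assms L2_set_triangle_ineq[of "\<lambda>i. cmod (x $ i)" "\<lambda>i. cmod (y $ i)" "{..<n}"]
    by simp
  finally show ?thesis .
qed

lemma vnorm_minus_commute:
  assumes "x \<in> carrier_vec n" "y \<in> carrier_vec n"
  shows "vnorm (x - y) = vnorm (y - x)"
  using assms by (auto simp: vnorm_def norm_minus_commute intro!: L2_set_cong)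

lemma vnorm_pos:
  assumes "x \<in> carrier_vec n" "x \<noteq> 0\<^sub>v n"
  shows "0 < vnorm x"
proof -
  have "vnorm x \<noteq> 0"
  proof
    assume "vnorm x = 0"
    then have "\<forall>i<n. x $ i = 0" using assms(1) by (auto simp: vnorm_def L2_set_eq_0_iff)
    then have "x = 0\<^sub>v n" using assms(1) by (intro eq_vecI) auto
    then show False using assms(2) by simp
  qed
  then show ?thesis using vnorm_nonneg[of x] by linarith
qed

lemma frob_nonneg [simp]: "0 \<le> frob A"
  by (simp add: frob_def sum_nonneg)

lemma frob_adjoint [simp]: "frob (mat_adjoint A) = frob A"
  unfolding frob_def by (subst sum.swap) (auto intro!: sum.cong)

lemma frob_col: "frob A = (\<Sum>j<dim_col A. (vnorm (col A j))\<^sup>2)"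
  unfolding frob_def vnorm_sq by (subst sum.swap) (auto intro!: sum.cong)

text \<open>Pythagoras: a diagonal Gram matrix says that the columns of \<open>A\<close> are
  orthogonal. It serves unitary matrices as well as \<open>A * U\<close> in the singular value
  decomposition.\<close>

lemma vnorm_mult_diagonal_gram:
  assumes A: "A \<in> carrier_mat m n" and x: "x \<in> carrier_vec n"
    and diag: "\<And>i j. i < n \<Longrightarrow> j < n \<Longrightarrow> i \<noteq> j \<Longrightarrow> (mat_adjoint A * A) $$ (i,j) = 0"
  shows "(vnorm (A *\<^sub>v x))\<^sup>2 = (\<Sum>i<n. (cmod (x $ i))\<^sup>2 * (vnorm (col A i))\<^sup>2)"
proof -
  have gram: "(\<Sum>k<m. A $$ (k,i) * cnj (A $$ (k,j))) = (mat_adjoint A * A) $$ (j,i)" if "i < n" "j < n" for i j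
    using that A by (auto simp: scalar_prod_def atLeast0LessThan mult.commute intro!: sum.cong)
  have gram_diag: "(mat_adjoint A * A) $$ (i,i) = complex_of_real ((vnorm (col A i))\<^sup>2)" if "i < n" for i
    using that A by (auto simp: vnorm_sq of_real_cmod_sq scalar_prod_def atLeast0LessThan mult.commute intro!: sum.cong)
  \<comment> \<open>The square is expanded over the complex numbers, where the squared modulus is
    \<open>z * cnj z\<close>; the result is real again.\<close>
  have "complex_of_real ((vnorm (A *\<^sub>v x))\<^sup>2)
      = (\<Sum>k<m. (\<Sum>i<n. A $$ (k,i) * x $ i) * cnj (\<Sum>j<n. A $$ (k,j) * x $ j))"
    using A x by (simp add: vnorm_sq of_real_cmod_sq scalar_prod_def atLeast0LessThan)
  also have "\<dots> = (\<Sum>k<m. \<Sum>i<n. \<Sum>j<n. x $ i * cnj (x $ j) * (A $$ (k,i) * cnj (A $$ (k,j))))"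
    by (simp add: sum_product mult_ac)
  also have "\<dots> = (\<Sum>i<n. \<Sum>j<n. \<Sum>k<m. x $ i * cnj (x $ j) * (A $$ (k,i) * cnj (A $$ (k,j))))"
    by (subst sum.swap, intro sum.cong refl sum.swap)
  also have "\<dots> = (\<Sum>i<n. \<Sum>j<n. x $ i * cnj (x $ j) * (mat_adjoint A * A) $$ (j,i))"
    by (intro sum.cong refl) (simp add: gram[symmetric] sum_distrib_left)
  also have "\<dots> = (\<Sum>i<n. x $ i * cnj (x $ i) * (mat_adjoint A * A) $$ (i,i))"
  proof (intro sum.cong refl)
    fix i assume i: "i \<in> {..<n}"
    have "(\<Sum>j<n. x $ i * cnj (x $ j) * (mat_adjoint A * A) $$ (j,i))
      = (\<Sum>j<n. if j = i then x $ i * cnj (x $ i) * (mat_adjoint A * A) $$ (i,i) else 0)"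
      using i by (intro sum.cong) (auto simp: diag)
    then show "(\<Sum>j<n. x $ i * cnj (x $ j) * (mat_adjoint A * A) $$ (j,i))
      = x $ i * cnj (x $ i) * (mat_adjoint A * A) $$ (i,i)" using i by simp
  qed
  also have "\<dots> = complex_of_real (\<Sum>i<n. (cmod (x $ i))\<^sup>2 * (vnorm (col A i))\<^sup>2)"
    by (simp add: gram_diag of_real_cmod_sq)
  finally show ?thesis using of_real_eq_iff by blast
qed

lemma is_unitary_col_vnorm:
  assumes "is_unitary n U" "i < n"
  shows "(vnorm (col U i))\<^sup>2 = 1"
proof -
  note u = is_unitaryD[OF assms(1)]
  have "complex_of_real ((vnorm (col U i))\<^sup>2) = (mat_adjoint U * U) $$ (i,i)"
    using u(1) assms(2) unfolding vnorm_sq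
    by (auto simp: scalar_prod_def atLeast0LessThan of_real_cmod_sq mult.commute intro!: sum.cong)
  also have "\<dots> = complex_of_real 1" using assms(2) unfolding u(3) by simp
  finally show ?thesis using of_real_eq_iff by blast
qed

lemma vnorm_unitary [simp]:
  assumes "is_unitary n U" "x \<in> carrier_vec n"
  shows "vnorm (U *\<^sub>v x) = vnorm x"
proof -
  note u = is_unitaryD[OF assms(1)]
  have "(vnorm (U *\<^sub>v x))\<^sup>2 = (\<Sum>i<n. (cmod (x $ i))\<^sup>2 * (vnorm (col U i))\<^sup>2)"
    using u by (intro vnorm_mult_diagonal_gram assms(2)) auto
  also have "\<dots> = (vnorm x)\<^sup>2"
    using assms(2) by (simp add: is_unitary_col_vnorm[OF assms(1)] vnorm_sq[of x])
  finally show ?thesis by simp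
qed

lemma frob_unitary_left:
  assumes U: "is_unitary n U" and A: "A \<in> carrier_mat n m"
  shows "frob (U * A) = frob A"
proof -
  note u = is_unitaryD[OF U]
  have "vnorm (col (U * A) j) = vnorm (col A j)" if "j < m" for j
  proof -
    have "col (U * A) j = U *\<^sub>v col A j" using col_mult2[OF u(1) A that] .
    moreover have "col A j \<in> carrier_vec n" using A that by (auto intro: carrier_vecI)
    ultimately show ?thesis using vnorm_unitary[OF U] by simp
  qed
  then show ?thesis using A by (simp add: frob_col)
qed

lemma frob_unitary_right:
  assumes U: "is_unitary n U" and A: "A \<in> carrier_mat m n"
  shows "frob (A * U) = frob A"
proof -
  note u = is_unitaryD[OF U]
  have "frob (A * U) = frob (mat_adjoint (A * U))" by simp
  also have "mat_adjoint (A * U) = mat_adjoint U * mat_adjoint A"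
    by (rule mat_adjoint_mult[OF A u(1)])
  also have "frob \<dots> = frob (mat_adjoint A)"
    using A by (intro frob_unitary_left[OF is_unitary_adjoint[OF U], of _ m]) simp
  finally show ?thesis by simp
qed

section \<open>Normal matrices and their triangular parts\<close>

text \<open>The two sums are the \<open>i\<close>-th diagonal entries of
  \<open>A * mat_adjoint A\<close> and \<open>mat_adjoint A * A\<close>.\<close>

lemma normal_mat_row_col:
  assumes A: "A \<in> carrier_mat n n" "normal_mat A" and i: "i < n"
  shows "(\<Sum>j<n. (cmod (A $$ (i,j)))\<^sup>2) = (\<Sum>j<n. (cmod (A $$ (j,i)))\<^sup>2)"
proof -
  have "complex_of_real (\<Sum>j<n. (cmod (A $$ (i,j)))\<^sup>2) = (A * mat_adjoint A) $$ (i,i)"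
    using A(1) i by (auto simp: scalar_prod_def atLeast0LessThan of_real_cmod_sq intro!: sum.cong)
  also have "\<dots> = (mat_adjoint A * A) $$ (i,i)"
    using A(2) by (simp add: normal_mat_def)
  also have "\<dots> = complex_of_real (\<Sum>j<n. (cmod (A $$ (j,i)))\<^sup>2)"
    using A(1) i by (auto simp: scalar_prod_def atLeast0LessThan of_real_cmod_sq mult.commute intro!: sum.cong)
  finally show ?thesis using of_real_eq_iff by blast
qed

text \<open>Weighting the equality of the \<open>i\<close>-th row and column norms by \<open>i\<close> makes the part above the
  diagonal balance the part below it.\<close>

lemma normal_mat_weighted_sum:
  assumes A: "A \<in> carrier_mat n n" "normal_mat A"
  shows "(\<Sum>i<n. \<Sum>j<n. (real j - real i) * (cmod (A $$ (i,j)))\<^sup>2) = 0"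
proof -
  have "(\<Sum>i<n. \<Sum>j<n. real j * (cmod (A $$ (i,j)))\<^sup>2) = (\<Sum>j<n. real j * (\<Sum>i<n. (cmod (A $$ (i,j)))\<^sup>2))"
    by (subst sum.swap) (simp add: sum_distrib_left)
  also have "\<dots> = (\<Sum>j<n. real j * (\<Sum>i<n. (cmod (A $$ (j,i)))\<^sup>2))"
    using normal_mat_row_col[OF A] by simp
  also have "\<dots> = (\<Sum>i<n. \<Sum>j<n. real i * (cmod (A $$ (i,j)))\<^sup>2)"
    by (simp add: sum_distrib_left)
  finally show ?thesis by (simp add: left_diff_distrib sum_subtractf)
qed

text \<open>For an upper triangular matrix every term of the weighted sum is nonnegative. As the sum
  vanishes, so does each term, and off the diagonal the weight is nonzero.\<close>

lemma normal_upper_triangular_imp_diagonal: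
  assumes A: "A \<in> carrier_mat n n" "normal_mat A" "upper_triangular A" and ij: "i < n" "j < n" "i \<noteq> j"
  shows "A $$ (i,j) = 0"
proof -
  have nonneg: "0 \<le> (real j - real i) * (cmod (A $$ (i,j)))\<^sup>2" if "i < n" "j < n" for i j
    using that A(1) upper_triangularD[OF A(3), of j i] by (cases "j < i") auto
  have "(\<Sum>j<n. (real j - real i) * (cmod (A $$ (i,j)))\<^sup>2) = 0"
    by (rule sum_nonneg_0[OF _ _ normal_mat_weighted_sum[OF A(1,2)]])
      (use ij in \<open>auto intro!: sum_nonneg nonneg\<close>)
  then have "(real j - real i) * (cmod (A $$ (i,j)))\<^sup>2 = 0"
    by (rule sum_nonneg_0[rotated 2]) (use ij in \<open>auto intro!: nonneg\<close>)
  then show ?thesis using ij by auto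
qed

text \<open>In the vanishing weighted sum the weight \<open>j - i\<close> is at least
  \<open>1\<close> above the diagonal and at least \<open>-(n - 1)\<close> below it.\<close>

lemma normal_upper_le_lower:
  assumes A: "A \<in> carrier_mat n n" "normal_mat A"
  shows "(\<Sum>i<n. \<Sum>j<n. if i < j then (cmod (A $$ (i,j)))\<^sup>2 else 0)
    \<le> (real n - 1) * (\<Sum>i<n. \<Sum>j<n. if j < i then (cmod (A $$ (i,j)))\<^sup>2 else 0)"
proof -
  \<comment> \<open>Adding the weighted sum, which is zero, to the right-hand side makes the
    inequality hold entry by entry.\<close>
  have "(\<Sum>i<n. \<Sum>j<n. if i < j then (cmod (A $$ (i,j)))\<^sup>2 else 0)
    \<le> (\<Sum>i<n. \<Sum>j<n. (real j - real i) * (cmod (A $$ (i,j)))\<^sup>2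
       + (real n - 1) * (if j < i then (cmod (A $$ (i,j)))\<^sup>2 else 0))"
  proof (intro sum_mono)
    fix i j assume "i \<in> {..<n}" "j \<in> {..<n}"
    then have ij: "i < n" "j < n" by auto
    define c where "c = (cmod (A $$ (i,j)))\<^sup>2"
    have c: "0 \<le> c" by (simp add: c_def)
    show "(if i < j then (cmod (A $$ (i,j)))\<^sup>2 else 0) \<le> (real j - real i) * (cmod (A $$ (i,j)))\<^sup>2
       + (real n - 1) * (if j < i then (cmod (A $$ (i,j)))\<^sup>2 else 0)"
      unfolding c_def[symmetric]
    proof (cases i j rule: linorder_cases)
      case less
      then have "1 * c \<le> (real j - real i) * c" by (intro mult_right_mono c) auto
      then show "(if i < j then c else 0) \<le> (real j - real i) * c + (real n - 1) * (if j < i then c else 0)"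
        using less by simp
    next
      case greater
      have "0 \<le> (real j - real i + (real n - 1)) * c" using ij by (intro mult_nonneg_nonneg c) linarith
      then show "(if i < j then c else 0) \<le> (real j - real i) * c + (real n - 1) * (if j < i then c else 0)"
        using greater by (simp add: algebra_simps)
    qed simp
  qed
  also have "\<dots> = (real n - 1) * (\<Sum>i<n. \<Sum>j<n. if j < i then (cmod (A $$ (i,j)))\<^sup>2 else 0)"
    using normal_mat_weighted_sum[OF A] by (simp add: sum.distrib sum_distrib_left)
  finally show ?thesis .
qed

lemma unitary_cancel:
  assumes "is_unitary n U" "X \<in> carrier_mat n m"
  shows "U * (mat_adjoint U * X) = X" "mat_adjoint U * (U * X) = X"
proof -
  note u = is_unitaryD[OF assms(1)]
  show "U * (mat_adjoint U * X) = X"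
    using u assms(2) by (subst assoc_mult_mat[symmetric, OF u(1,2)]) auto
  show "mat_adjoint U * (U * X) = X"
    using u assms(2) by (subst assoc_mult_mat[symmetric, OF u(2,1)]) auto
qed

lemma normal_mat_unitary_conj:
  assumes U: "is_unitary n U" and A: "A \<in> carrier_mat n n" "normal_mat A"
  shows "normal_mat (mat_adjoint U * A * U)"
proof -
  note u = is_unitaryD[OF U]
  note rls = assoc_mult_mat[of _ n n _ n _ n] mult_carrier_mat[of _ n n _ n]
  have adj: "mat_adjoint (mat_adjoint U * A * U) = mat_adjoint U * mat_adjoint A * U"
    using u A by (simp add: mat_adjoint_mult[of _ n n _ n] rls)
  have prod: "(mat_adjoint U * B * U) * (mat_adjoint U * C * U) = mat_adjoint U * (B * C) * U"
    if "B \<in> carrier_mat n n" "C \<in> carrier_mat n n" for B C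
    using u that by (simp add: rls unitary_cancel[OF U, of _ n])
  show ?thesis
    unfolding normal_mat_def adj using A by (simp add: prod normal_mat_def)
qed

text \<open>The Schur form of a normal matrix is normal and upper triangular, hence
  diagonal.\<close>

theorem normal_mat_spectral:
  assumes A: "A \<in> carrier_mat n n" "normal_mat A"
  obtains U d where "is_unitary n U" "A * U = U * mat n n (\<lambda>(i,j). if i = j then d i else 0)"
    "eigenvalue_mset A = image_mset d (mset [0..<n])"
proof -
  obtain U T where U: "is_unitary n U" and T: "T \<in> carrier_mat n n" "upper_triangular T" "A * U = U * T"
    and ev: "eigenvalue_mset A = image_mset (\<lambda>i. T $$ (i,i)) (mset [0..<n])"
    using unitary_schur[OF A(1)] by blast
  note u = is_unitaryD[OF U]
  have "mat_adjoint U * A * U = T"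
    using A u T unitary_cancel[OF U T(1)] by (simp add: assoc_mult_mat[of _ n n _ n _ n])
  then have "normal_mat T" using normal_mat_unitary_conj[OF U A] by simp
  then have "T = mat n n (\<lambda>(i,j). if i = j then T $$ (i,i) else 0)"
    using T normal_upper_triangular_imp_diagonal[OF T(1) _ T(2)] by (intro eq_matI) auto
  then show ?thesis using that[OF U _ ev] T(3) by simp
qed

section \<open>Perturbations of small Frobenius norm\<close>

theorem normal_perturbation_weights:
  assumes X: "X \<in> carrier_mat n n" "normal_mat X" and Y: "Y \<in> carrier_mat n n"
  obtains W a b where "is_unitary n W"
    "eigenvalue_mset X = image_mset a (mset [0..<n])"
    "eigenvalue_mset (X + Y) = image_mset b (mset [0..<n])"
    "(\<Sum>k<n. \<Sum>j<n. (cmod (W $$ (k,j)))\<^sup>2 * (cmod (a k - b j))\<^sup>2) \<le> real n * frob Y"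
proof -
  define diag where "diag d = mat n n (\<lambda>(i,j). if i = j then d i else 0)" for d :: "nat \<Rightarrow> complex"
  have diag [simp]: "diag d \<in> carrier_mat n n" for d by (simp add: diag_def)
  obtain V a where V: "is_unitary n V" and XV: "X * V = V * diag a"
    and a: "eigenvalue_mset X = image_mset a (mset [0..<n])"
    unfolding diag_def using normal_mat_spectral[OF X] by blast
  have XY: "X + Y \<in> carrier_mat n n" using X Y by simp
  obtain U T where U: "is_unitary n U" and T: "T \<in> carrier_mat n n" "upper_triangular T" "(X + Y) * U = U * T"
    and ev_T: "eigenvalue_mset (X + Y) = image_mset (\<lambda>i. T $$ (i,i)) (mset [0..<n])"
    using unitary_schur[OF XY] by blast
  define b where "b = (\<lambda>i. T $$ (i,i))"
  have ev: "eigenvalue_mset (X + Y) = image_mset b (mset [0..<n])"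
    unfolding ev_T b_def ..
  note u = is_unitaryD[OF U] and v = is_unitaryD[OF V]
  note rls = assoc_mult_mat[of _ n n _ n _ n] mult_carrier_mat[of _ n n _ n]
  define A P W where "A = mat_adjoint U * X * U" and "P = mat_adjoint U * Y * U" and "W = mat_adjoint V * U"
  have A: "A \<in> carrier_mat n n" and P: "P \<in> carrier_mat n n" and W: "W \<in> carrier_mat n n"
    using u v X Y by (simp_all add: A_def P_def W_def rls)
  have Wu: "is_unitary n W"
    unfolding W_def by (rule is_unitary_mult[OF is_unitary_adjoint[OF V] U])
  have "T = mat_adjoint U * ((X + Y) * U)"
    unfolding T(3) using unitary_cancel[OF U T(1)] by simp
  also have "\<dots> = A + P"
    using X Y u by (simp add: A_def P_def rls mult_add_distrib_mat[of _ n n _ n] add_mult_distrib_mat[of _ n n _ _ n])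
  finally have TAP: "T = A + P" .
  have PY: "frob P = frob Y"
  proof -
    have "frob P = frob (mat_adjoint U * Y)"
      unfolding P_def using u Y by (intro frob_unitary_right[OF U, of _ n]) (simp add: rls)
    also have "\<dots> = frob Y"
      by (rule frob_unitary_left[OF is_unitary_adjoint[OF U] Y])
    finally show ?thesis .
  qed
  \<comment> \<open>Below the diagonal the two summands of the triangular \<open>T\<close>
    cancel.\<close>
  have lower: "A $$ (i,j) = - P $$ (i,j)" if "j < i" "i < n" for i j
  proof -
    have "T $$ (i,j) = 0" using upper_triangularD[OF T(2), of j i] that T(1) by auto
    then show ?thesis using that A P unfolding TAP by (auto simp: eq_neg_iff_add_eq_0)
  qed
  \<comment> \<open>On and below the diagonal \<open>A - diag b\<close> agrees with
    \<open>- P\<close>, which costs at most \<open>frob P\<close>. The part above costs at most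
    \<open>n - 1\<close> times the lower part of \<open>P\<close>. The case \<open>n = 0\<close> is
    separate because there \<open>n - 1\<close> is negative.\<close>
  have AD: "frob (A - diag b) \<le> real n * frob Y"
  proof (cases "n = 0")
    case True
    then show ?thesis by (simp add: frob_def diag_def)
  next
    case False
    let ?lo = "\<lambda>M::complex mat. \<Sum>i<n. \<Sum>j<n. if j < i then (cmod (M $$ (i,j)))\<^sup>2 else 0"
    have entry_le: "(cmod ((A - diag b) $$ (i,j)))\<^sup>2 \<le> (if i < j then (cmod (A $$ (i,j)))\<^sup>2 else 0) + (cmod (P $$ (i,j)))\<^sup>2"
      if ij: "i < n" "j < n" for i j
    proof (cases i j rule: linorder_cases)
      case less
      then show ?thesis using ij A by (simp add: diag_def)
    next
      case equal
      then show ?thesis using ij A P unfolding b_def TAP by (simp add: diag_def)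
    next
      case greater
      then show ?thesis using ij A lower[of j i] by (simp add: diag_def)
    qed
    have "frob (A - diag b) = (\<Sum>i<n. \<Sum>j<n. (cmod ((A - diag b) $$ (i,j)))\<^sup>2)"
      by (simp add: frob_def diag_def)
    also have "\<dots> \<le> (\<Sum>i<n. \<Sum>j<n. (if i < j then (cmod (A $$ (i,j)))\<^sup>2 else 0) + (cmod (P $$ (i,j)))\<^sup>2)"
      by (intro sum_mono entry_le) auto
    also have "\<dots> = (\<Sum>i<n. \<Sum>j<n. if i < j then (cmod (A $$ (i,j)))\<^sup>2 else 0) + frob P"
      using P by (simp add: frob_def sum.distrib)
    also have "(\<Sum>i<n. \<Sum>j<n. if i < j then (cmod (A $$ (i,j)))\<^sup>2 else 0) \<le> (real n - 1) * ?lo A"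
      using normal_mat_unitary_conj[OF U X] by (intro normal_upper_le_lower[OF A]) (simp add: A_def)
    also have "?lo A = ?lo P"
      by (intro sum.cong refl) (auto simp: lower)
    also have "(real n - 1) * ?lo P \<le> (real n - 1) * frob P"
    proof -
      have "?lo P \<le> (\<Sum>i<n. \<Sum>j<n. (cmod (P $$ (i,j)))\<^sup>2)"
        by (intro sum_mono) auto
      then show ?thesis using False P by (intro mult_left_mono) (auto simp: frob_def)
    qed
    finally show ?thesis using PY by (simp add: algebra_simps)
  qed
  have "mat_adjoint V * X = mat_adjoint V * (X * V) * mat_adjoint V"
    using X v by (simp add: rls)
  also have "\<dots> = diag a * mat_adjoint V"
    unfolding XV using v unitary_cancel[OF V diag[of a]] by simp
  finally have VX: "mat_adjoint V * X = diag a * mat_adjoint V" .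
  have "W * A = (mat_adjoint V * X) * U"
    unfolding W_def A_def using u v X by (simp add: rls unitary_cancel[OF U, of _ n])
  also have "\<dots> = diag a * W"
    unfolding VX W_def using u v by (simp add: rls)
  finally have WA: "W * A = diag a * W" .
  \<comment> \<open>By \<open>WA\<close> the product is \<open>diag a * W - W * diag b\<close>, so
    each entry of \<open>W\<close> is multiplied by a difference of eigenvalues.\<close>
  have entry: "(W * (A - diag b)) $$ (k,j) = W $$ (k,j) * (a k - b j)" if kj: "k < n" "j < n" for k j
  proof -
    have "W * (A - diag b) = diag a * W - W * diag b"
      unfolding WA[symmetric] by (rule mult_minus_distrib_mat[OF W A diag])
    moreover have "(diag a * W) $$ (k,j) = (\<Sum>i<n. (if k = i then a k else 0) * W $$ (i,j))"
      using kj W by (simp add: diag_def scalar_prod_def atLeast0LessThan)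
    then have "(diag a * W) $$ (k,j) = a k * W $$ (k,j)"
      using kj by (simp add: mult_delta_left)
    moreover have "(W * diag b) $$ (k,j) = (\<Sum>i<n. W $$ (k,i) * (if i = j then b i else 0))"
      using kj W by (simp add: diag_def scalar_prod_def atLeast0LessThan)
    then have "(W * diag b) $$ (k,j) = W $$ (k,j) * b j"
      using kj by (simp add: mult_delta_right)
    ultimately show ?thesis using kj W by (simp add: diag_def algebra_simps del: index_mult_mat(1))
  qed
  have "(\<Sum>k<n. \<Sum>j<n. (cmod (W $$ (k,j)))\<^sup>2 * (cmod (a k - b j))\<^sup>2) = frob (W * (A - diag b))"
  proof -
    have "W * (A - diag b) \<in> carrier_mat n n" by (intro mult_carrier_mat[OF W] minus_carrier_mat diag)
    then have "frob (W * (A - diag b)) = (\<Sum>k<n. \<Sum>j<n. (cmod ((W * (A - diag b)) $$ (k,j)))\<^sup>2)"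
      unfolding frob_def by (simp only: carrier_matD)
    also have "\<dots> = (\<Sum>k<n. \<Sum>j<n. (cmod (W $$ (k,j)))\<^sup>2 * (cmod (a k - b j))\<^sup>2)"
      by (intro sum.cong refl) (simp only: entry lessThan_iff norm_mult power_mult_distrib)
    finally show ?thesis by simp
  qed
  also have "\<dots> = frob (A - diag b)"
    by (intro frob_unitary_left[OF Wu, of _ n] minus_carrier_mat diag)
  also have "\<dots> \<le> real n * frob Y" by (rule AD)
  finally show ?thesis by (rule that[OF Wu a ev])
qed

section \<open>Averaging with doubly stochastic weights\<close>

lemma sum_unitary_col:
  assumes "is_unitary n W" "j < n"
  shows "(\<Sum>k<n. (cmod (W $$ (k,j)))\<^sup>2) = 1"
  using is_unitary_col_vnorm[OF assms] is_unitaryD(1)[OF assms(1)] assms(2) by (simp add: vnorm_sq)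

lemma sum_unitary_row:
  assumes "is_unitary n W" "k < n"
  shows "(\<Sum>j<n. (cmod (W $$ (k,j)))\<^sup>2) = 1"
proof -
  have "(\<Sum>j<n. (cmod (W $$ (k,j)))\<^sup>2) = (\<Sum>j<n. (cmod (mat_adjoint W $$ (j,k)))\<^sup>2)"
    using is_unitaryD(1)[OF assms(1)] assms(2) by (intro sum.cong) auto
  then show ?thesis using sum_unitary_col[OF is_unitary_adjoint[OF assms(1)] assms(2)] by simp
qed

text \<open>Unit column sums spread each \<open>F (b j)\<close> over all \<open>k\<close>, unit row
  sums spread each \<open>F (a k)\<close> over all \<open>j\<close>. The difference becomes a
  weighted sum of \<open>F (b j) - F (a k)\<close> of total weight \<open>n\<close>, with no
  matching of eigenvalues.\<close>

lemma sum_diff_le_of_weights: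
  fixes F :: "complex \<Rightarrow> complex"
  assumes W: "is_unitary n W"
    and K: "(\<Sum>k<n. \<Sum>j<n. (cmod (W $$ (k,j)))\<^sup>2 * (cmod (a k - b j))\<^sup>2) \<le> K"
    and F: "\<And>x y. cmod (F x - F y) \<le> e + C * (cmod (x - y))\<^sup>2" and C: "0 \<le> C"
  shows "cmod ((\<Sum>j<n. F (b j)) - (\<Sum>k<n. F (a k))) \<le> real n * e + C * K"
proof -
  let ?w = "\<lambda>k j. (cmod (W $$ (k,j)))\<^sup>2"
  have "(\<Sum>j<n. F (b j)) = (\<Sum>j<n. complex_of_real (\<Sum>k<n. ?w k j) * F (b j))"
    by (intro sum.cong) (auto simp del: of_real_sum simp add: sum_unitary_col[OF W])
  also have "\<dots> = (\<Sum>k<n. \<Sum>j<n. complex_of_real (?w k j) * F (b j))"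
    by (subst sum.swap) (simp add: sum_distrib_right)
  finally have b: "(\<Sum>j<n. F (b j)) = (\<Sum>k<n. \<Sum>j<n. complex_of_real (?w k j) * F (b j))" .
  have "(\<Sum>k<n. F (a k)) = (\<Sum>k<n. complex_of_real (\<Sum>j<n. ?w k j) * F (a k))"
    by (intro sum.cong) (auto simp del: of_real_sum simp add: sum_unitary_row[OF W])
  also have "\<dots> = (\<Sum>k<n. \<Sum>j<n. complex_of_real (?w k j) * F (a k))"
    by (simp add: sum_distrib_right)
  finally have a: "(\<Sum>k<n. F (a k)) = (\<Sum>k<n. \<Sum>j<n. complex_of_real (?w k j) * F (a k))" .
  have "cmod ((\<Sum>j<n. F (b j)) - (\<Sum>k<n. F (a k)))
      = cmod (\<Sum>k<n. \<Sum>j<n. complex_of_real (?w k j) * (F (b j) - F (a k)))"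
    unfolding a b by (simp add: sum_subtractf right_diff_distrib)
  also have "\<dots> \<le> (\<Sum>k<n. \<Sum>j<n. ?w k j * (e + C * (cmod (a k - b j))\<^sup>2))"
  proof (intro order_trans[OF norm_sum] sum_mono)
    fix k j
    have "cmod (complex_of_real (?w k j) * (F (b j) - F (a k))) = ?w k j * cmod (F (a k) - F (b j))"
      by (simp add: norm_mult norm_minus_commute norm_power)
    also have "\<dots> \<le> ?w k j * (e + C * (cmod (a k - b j))\<^sup>2)"
      by (intro mult_left_mono F) simp
    finally show "cmod (complex_of_real (?w k j) * (F (b j) - F (a k))) \<le> ?w k j * (e + C * (cmod (a k - b j))\<^sup>2)" .
  qed
  also have "\<dots> = e * (\<Sum>k<n. \<Sum>j<n. ?w k j) + C * (\<Sum>k<n. \<Sum>j<n. ?w k j * (cmod (a k - b j))\<^sup>2)"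
    by (simp add: sum.distrib sum_distrib_left algebra_simps)
  also have "\<dots> \<le> real n * e + C * K"
    using mult_left_mono[OF K C] by (simp add: sum_unitary_row[OF W])
  finally show ?thesis .
qed

section \<open>Continuity estimates for test functions\<close>

text \<open>Compactness gives uniform continuity on a ball one unit larger than one containing the
  support. If two points closer than \<open>1\<close> are not both in the larger ball, both lie
  outside the support.\<close>

lemma uniform_continuity_bounded_support:
  fixes F :: "'a::heine_borel \<Rightarrow> 'b::real_normed_vector"
  assumes F: "continuous_on UNIV F" and b: "bounded {z. F z \<noteq> 0}" and e: "0 < e"
  obtains d where "0 < d" "\<And>x y. dist x y < d \<Longrightarrow> dist (F x) (F y) < e"
proof -
  obtain x0 r where r: "\<And>z. F z \<noteq> 0 \<Longrightarrow> dist x0 z \<le> r"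
    using b unfolding bounded_def by blast
  have "uniformly_continuous_on (cball x0 (r + 1)) F"
    using F by (intro compact_uniformly_continuous continuous_on_subset[OF F]) auto
  then obtain d where d: "0 < d" "\<And>x y. x \<in> cball x0 (r + 1) \<Longrightarrow> y \<in> cball x0 (r + 1) \<Longrightarrow> dist y x < d \<Longrightarrow> dist (F y) (F x) < e"
    using e unfolding uniformly_continuous_on_def by metis
  have "dist (F x) (F y) < e" if xy: "dist x y < min d 1" for x y
  proof (cases "x \<in> cball x0 (r + 1) \<and> y \<in> cball x0 (r + 1)")
    case True
    then show ?thesis using d(2)[of y x] xy by simp
  next
    case False
    have "dist x0 x \<le> dist x0 y + dist x y" "dist x0 y \<le> dist x0 x + dist x y"
      by (metis dist_commute dist_triangle) (rule dist_triangle)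
    then have "dist x0 x > r" "dist x0 y > r" using False xy by auto
    then have "F x = 0" "F y = 0" using r by force+
    then show ?thesis using e by simp
  qed
  then show ?thesis using that[of "min d 1"] d(1) by simp
qed

lemma bounded_range_bounded_support:
  fixes F :: "'a::heine_borel \<Rightarrow> 'b::real_normed_vector"
  assumes F: "continuous_on UNIV F" and b: "bounded {z. F z \<noteq> 0}"
  obtains M where "0 \<le> M" "\<And>x. norm (F x) \<le> M"
proof -
  obtain x0 r where r: "\<And>z. F z \<noteq> 0 \<Longrightarrow> dist x0 z \<le> r"
    using b unfolding bounded_def by blast
  have "compact (F ` cball x0 r)"
    by (intro compact_continuous_image continuous_on_subset[OF F]) auto
  then obtain M where M: "\<And>z. z \<in> cball x0 r \<Longrightarrow> norm (F z) \<le> M"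
    using compact_imp_bounded[of "F ` cball x0 r"] unfolding bounded_iff by (metis imageI)
  \<comment> \<open>The ball may be empty, and then \<open>M\<close> may be negative.\<close>
  have "norm (F z) \<le> max M 0" for z
    using M[of z] r[of z] by (cases "F z = 0") auto
  then show ?thesis using that[of "max M 0"] by simp
qed

text \<open>Uniform continuity handles points closer than \<open>d\<close>; farther apart,
  \<open>C * d\<^sup>2 = 2 * M\<close> already bounds the oscillation. The quadratic form matches
  the squared distances controlled by the Frobenius norm.\<close>

lemma quadratic_modulus_bounded_support:
  fixes F :: "complex \<Rightarrow> complex"
  assumes F: "continuous_on UNIV F" and b: "bounded {z. F z \<noteq> 0}" and e: "0 < e"
  obtains C where "0 \<le> C" "\<And>x y. cmod (F x - F y) \<le> e + C * (cmod (x - y))\<^sup>2"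
proof -
  obtain d where d: "0 < d" "\<And>x y. dist x y < d \<Longrightarrow> dist (F x) (F y) < e"
    using uniform_continuity_bounded_support[OF F b e] by blast
  obtain M where M: "0 \<le> M" "\<And>x. cmod (F x) \<le> M"
    using bounded_range_bounded_support[OF F b] by blast
  define C where "C = 2 * M / d\<^sup>2"
  have C: "0 \<le> C" using M(1) by (simp add: C_def)
  have "cmod (F x - F y) \<le> e + C * (cmod (x - y))\<^sup>2" for x y
  proof (cases "dist x y < d")
    case True
    then show ?thesis using d(2)[OF True] C by (simp add: dist_norm add_increasing2)
  next
    case False
    then have "d\<^sup>2 \<le> (cmod (x - y))\<^sup>2" using d(1) by (intro power_mono) (auto simp: dist_norm)
    then have "2 * M \<le> C * (cmod (x - y))\<^sup>2"
      using d(1) M(1) mult_left_mono[of "d\<^sup>2" "(cmod (x - y))\<^sup>2" C] C by (simp add: C_def)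
    moreover have "cmod (F x - F y) \<le> 2 * M"
      using norm_triangle_ineq4[of "F x" "F y"] M(2)[of x] M(2)[of y] by linarith
    ultimately show ?thesis using e by linarith
  qed
  then show ?thesis using that C by blast
qed

section \<open>Singular values and Schatten norms\<close>

text \<open>Diagonalising the Hermitian matrix \<open>mat_adjoint A * A\<close> by \<open>U\<close>
  makes the columns of \<open>A * U\<close> orthogonal; the diagonal entries are their squared
  lengths.\<close>

lemma singular_value_mset_unitary:
  assumes A: "A \<in> carrier_mat n n"
  obtains U where "is_unitary n U"
    "singular_value_mset A = image_mset (\<lambda>i. vnorm (col (A * U) i)) (mset [0..<n])"
    "diagonal_mat (mat_adjoint (A * U) * (A * U))"
proof -
  define H where "H = mat_adjoint A * A"
  have H: "H \<in> carrier_mat n n" unfolding H_def using A by (metis mat_adjoint_carrier mult_carrier_mat)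
  have "mat_adjoint H = H"
    unfolding H_def using A by (simp add: mat_adjoint_mult[of _ n n _ n])
  then have "normal_mat H" by (simp add: normal_mat_def)
  then obtain U d where U: "is_unitary n U" and HU: "H * U = U * mat n n (\<lambda>(i,j). if i = j then d i else 0)"
    and d: "eigenvalue_mset H = image_mset d (mset [0..<n])"
    using normal_mat_spectral[OF H] by blast
  note u = is_unitaryD[OF U]
  have AU: "A * U \<in> carrier_mat n n" using A u by simp
  have "mat_adjoint (A * U) * (A * U) = mat_adjoint U * (H * U)"
    unfolding H_def mat_adjoint_mult[OF A u(1)] using A u
    by (simp add: assoc_mult_mat[of _ n n _ n _ n] mult_carrier_mat[of _ n n _ n])
  also have "\<dots> = mat n n (\<lambda>(i,j). if i = j then d i else 0)"
    unfolding HU by (rule unitary_cancel(2)[OF U, of _ n]) simp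
  finally have G: "mat_adjoint (A * U) * (A * U) = mat n n (\<lambda>(i,j). if i = j then d i else 0)" .
  have "d i = complex_of_real ((vnorm (col (A * U) i))\<^sup>2)" if "i < n" for i
  proof -
    have "d i = (mat_adjoint (A * U) * (A * U)) $$ (i,i)" unfolding G using that by simp
    also have "\<dots> = (\<Sum>k<n. cnj ((A * U) $$ (k,i)) * (A * U) $$ (k,i))"
      using AU that by (subst index_mult_mat) (auto simp: scalar_prod_def atLeast0LessThan simp del: index_mult_mat intro!: sum.cong)
    also have "\<dots> = complex_of_real ((vnorm (col (A * U) i))\<^sup>2)"
      using AU that unfolding vnorm_sq
      by (auto simp: of_real_cmod_sq mult.commute simp del: index_mult_mat intro!: sum.cong)
    finally show ?thesis .
  qed
  then have "sqrt (Re (d i)) = vnorm (col (A * U) i)" if "i < n" for i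
    using that by simp
  then have "singular_value_mset A = image_mset (\<lambda>i. vnorm (col (A * U) i)) (mset [0..<n])"
    unfolding singular_value_mset_def H_def[symmetric] d
    by (auto simp: multiset.map_comp o_def intro!: image_mset_cong)
  moreover have "diagonal_mat (mat_adjoint (A * U) * (A * U))"
    unfolding G by (simp add: diagonal_mat_def)
  ultimately show ?thesis using U that by blast
qed

lemma sum_mset_upt: "(\<Sum>x\<in>#image_mset f (mset [0..<n]). g x) = (\<Sum>i<n. g (f i))"
  by (simp only: sum_unfold_sum_mset multiset.map_comp o_def mset_upt atLeast0LessThan)

text \<open>The Frobenius norm is unitarily invariant, and the columns of \<open>A * U\<close> have
  the singular values as lengths.\<close>

lemma frob_eq_sum_singular_values:
  assumes A: "A \<in> carrier_mat n n"
  obtains s where "singular_value_mset A = image_mset s (mset [0..<n])"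
    "frob A = (\<Sum>i<n. (s i)\<^sup>2)" "\<And>i::nat. 0 \<le> (s i :: real)"
proof -
  obtain U where U: "is_unitary n U"
    and s: "singular_value_mset A = image_mset (\<lambda>i. vnorm (col (A * U) i)) (mset [0..<n])"
    using singular_value_mset_unitary[OF A] by blast
  have "frob A = frob (A * U)" using frob_unitary_right[OF U A] by simp
  also have "\<dots> = (\<Sum>i<n. (vnorm (col (A * U) i))\<^sup>2)"
    using is_unitaryD(1)[OF U] by (simp add: frob_col)
  finally show ?thesis using that[OF s] by simp
qed

text \<open>With \<open>x = U y\<close>, Pythagoras applies to the orthogonal columns of
  \<open>A * U\<close>, none longer than the largest singular value.\<close>

lemma vnorm_mult_le_spectral_norm:
  assumes A: "A \<in> carrier_mat n n" and x: "x \<in> carrier_vec n"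
  shows "vnorm (A *\<^sub>v x) \<le> spectral_norm A * vnorm x"
proof -
  obtain U where U: "is_unitary n U"
    and s: "singular_value_mset A = image_mset (\<lambda>i. vnorm (col (A * U) i)) (mset [0..<n])"
    and diag: "diagonal_mat (mat_adjoint (A * U) * (A * U))"
    using singular_value_mset_unitary[OF A] by blast
  note u = is_unitaryD[OF U]
  have AU: "A * U \<in> carrier_mat n n" using A u by simp
  define y where "y = mat_adjoint U *\<^sub>v x"
  have y: "y \<in> carrier_vec n" using u x by (simp add: y_def mult_mat_vec_carrier[of _ n n])
  have xy: "x = U *\<^sub>v y"
    using u x by (simp add: y_def assoc_mult_mat_vec[symmetric, of _ n n _ n])
  let ?M = "spectral_norm A"
  have M: "?M = Max (insert 0 (set_mset (singular_value_mset A)))" by (simp add: schatten_norm_def)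
  have M0: "0 \<le> ?M" unfolding M by (intro Max_ge) auto
  have le: "vnorm (col (A * U) i) \<le> ?M" if "i < n" for i
    unfolding M s using that by (intro Max_ge) auto
  have "(vnorm (A *\<^sub>v x))\<^sup>2 = (vnorm ((A * U) *\<^sub>v y))\<^sup>2"
    unfolding xy using A u y by simp
  also have "\<dots> = (\<Sum>i<n. (cmod (y $ i))\<^sup>2 * (vnorm (col (A * U) i))\<^sup>2)"
    using diag AU by (intro vnorm_mult_diagonal_gram[OF AU y]) (auto simp: diagonal_mat_def)
  also have "\<dots> \<le> (\<Sum>i<n. (cmod (y $ i))\<^sup>2 * ?M\<^sup>2)"
    by (intro sum_mono mult_left_mono power_mono) (auto simp: le)
  also have "\<dots> = (?M * vnorm y)\<^sup>2"
    using y by (simp add: vnorm_sq sum_distrib_left power_mult_distrib mult.commute)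
  finally have "vnorm (A *\<^sub>v x) \<le> ?M * vnorm y"
    by (rule power2_le_imp_le) (use M0 in simp)
  also have "vnorm y = vnorm x" unfolding xy using U y by simp
  finally show ?thesis .
qed

section \<open>Comparing Schatten norms with the Frobenius norm\<close>

text \<open>After division by the \<open>p\<close>-norm \<open>m\<close> every entry is at most
  \<open>1\<close>, so lowering the exponent from \<open>2\<close> to \<open>p\<close> can only
  increase it.\<close>

lemma sum_squares_le_p_norm:
  fixes s :: "nat \<Rightarrow> real" and p :: real
  assumes s: "\<And>i. 0 \<le> s i" and p: "1 \<le> p" "p \<le> 2"
  shows "(\<Sum>i<n. (s i)\<^sup>2) \<le> ((\<Sum>i<n. s i powr p) powr (1 / p))\<^sup>2"
proof -
  define S where "S = (\<Sum>i<n. s i powr p)"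
  define m where "m = S powr (1 / p)"
  have S: "0 \<le> S" by (simp add: S_def sum_nonneg)
  show ?thesis
  proof (cases "S = 0")
    case True
    have "s i = 0" if "i < n" for i
    proof -
      have "s i powr p = 0"
        by (rule sum_nonneg_0[OF _ _ True[unfolded S_def]]) (use that in auto)
      then show ?thesis by simp
    qed
    then show ?thesis by simp
  next
    case False
    then have "0 < S" using S by simp
    then have m: "0 < m" by (simp add: m_def)
    have mp: "m powr p = S" using p \<open>0 < S\<close> by (simp add: m_def powr_powr)
    have "(s i)\<^sup>2 \<le> m\<^sup>2 * (s i powr p / S)" if "i < n" for i
    proof -
      have "s i powr p \<le> S" unfolding S_def using that by (intro member_le_sum) auto
      then have "s i powr p \<le> m powr p" using mp by simp
      then have "s i \<le> m" using powr_less_mono2[of p m "s i"] m p by fastforce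
      then have "(s i / m) powr 2 \<le> (s i / m) powr p"
        using m s[of i] p by (intro powr_mono') auto
      then have "(s i / m)\<^sup>2 \<le> s i powr p / S"
        using m s[of i] mp by (simp add: powr_divide power_divide)
      then show ?thesis using m by (simp add: power_divide field_simps)
    qed
    then have "(\<Sum>i<n. (s i)\<^sup>2) \<le> (\<Sum>i<n. m\<^sup>2 * (s i powr p / S))" by (intro sum_mono) auto
    also have "\<dots> = m\<^sup>2 * ((\<Sum>i<n. s i powr p) / S)" by (simp add: sum_distrib_left sum_divide_distrib)
    also have "(\<Sum>i<n. s i powr p) = S" by (simp add: S_def)
    finally show ?thesis using False by (simp add: m_def S_def)
  qed
qed

text \<open>Splitting at \<open>t = n\<^sup>-\<^sup>1\<^sup>/\<^sup>p \<parallel>s\<parallel>\<^sub>p\<close> replaces Hoelder's inequality: \<open>s\<^sup>2 \<le> t\<^sup>2 (1 + (s/t)\<^sup>p)\<close>, at the price of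
  the factor \<open>2\<close>.\<close>

lemma sum_squares_le_p_norm_dim:
  fixes s :: "nat \<Rightarrow> real" and p :: real
  assumes s: "\<And>i. 0 \<le> s i" and p: "2 \<le> p"
  shows "(\<Sum>i<n. (s i)\<^sup>2) \<le> 2 * (real n powr (1 / 2 - 1 / p) * (\<Sum>i<n. s i powr p) powr (1 / p))\<^sup>2"
proof -
  define S where "S = (\<Sum>i<n. s i powr p)"
  define m where "m = S powr (1 / p)"
  have S: "0 \<le> S" by (simp add: S_def sum_nonneg)
  show ?thesis
  proof (cases "S = 0 \<or> n = 0")
    case True
    have "s i = 0" if "i < n" for i
    proof -
      have "s i powr p = 0"
        by (rule sum_nonneg_0[of "{..<n}" "\<lambda>i. s i powr p"]) (use True that in \<open>auto simp: S_def\<close>)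
      then show ?thesis by simp
    qed
    then show ?thesis by simp
  next
    case False
    then have "0 < S" using S by simp
    then have m: "0 < m" by (simp add: m_def)
    have mp: "m powr p = S" using p \<open>0 < S\<close> by (simp add: m_def powr_powr)
    have n: "0 < real n" using False by simp
    define t where "t = m * real n powr (- 1 / p)"
    have t: "0 < t" using m n by (simp add: t_def)
    have tp: "t powr p = S / n"
      using m n p by (simp add: t_def powr_mult powr_divide mp powr_powr powr_minus_divide)
    have "(s i)\<^sup>2 \<le> t\<^sup>2 * (1 + s i powr p / (S / n))" for i
    proof (cases "s i \<le> t")
      case True
      have "(s i)\<^sup>2 \<le> t\<^sup>2 * 1" using True s[of i] by (simp add: power_mono)
      also have "\<dots> \<le> t\<^sup>2 * (1 + s i powr p / (S / n))" using S by (intro mult_left_mono) auto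
      finally show ?thesis .
    next
      case False
      then have "(s i / t) powr 2 \<le> (s i / t) powr p"
        using t p by (intro powr_mono) auto
      then have "(s i / t)\<^sup>2 \<le> 1 + s i powr p / (S / n)"
        using t s[of i] by (simp add: powr_divide power_divide tp[symmetric])
      then show ?thesis using t by (simp add: power_divide field_simps)
    qed
    then have "(\<Sum>i<n. (s i)\<^sup>2) \<le> (\<Sum>i<n. t\<^sup>2 * (1 + s i powr p / (S / n)))" by (intro sum_mono) auto
    also have "\<dots> = t\<^sup>2 * (n + (\<Sum>i<n. s i powr p) / (S / n))"
      by (simp only: sum_distrib_left[symmetric] sum_divide_distrib sum.distrib) simp
    also have "(\<Sum>i<n. s i powr p) = S" by (simp add: S_def)
    \<comment> \<open>The constant terms and the ratios each sum to \<open>n\<close>, whence the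
      factor \<open>2\<close>.\<close>
    also have "t\<^sup>2 * (n + S / (S / n)) = 2 * (n * t\<^sup>2)" using False by simp
    also have "n * t\<^sup>2 = (real n powr (1 / 2 - 1 / p) * m)\<^sup>2"
    proof -
      have "real n = (real n powr (1 / 2))\<^sup>2" using n by (simp add: powr_half_sqrt)
      then have "n * t\<^sup>2 = (real n powr (1 / 2) * t)\<^sup>2" by (simp add: power_mult_distrib)
      also have "real n powr (1 / 2) * t = real n powr (1 / 2 - 1 / p) * m"
        by (simp add: t_def powr_diff powr_minus_divide)
      finally show ?thesis .
    qed
    finally show ?thesis by (simp add: m_def S_def)
  qed
qed

lemma schatten_norm_nonneg: "0 \<le> schatten_norm p A"
  by (auto simp: schatten_norm_def intro!: Max_ge)

lemma frob_le_schatten_norm: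
  assumes A: "A \<in> carrier_mat n n" and p: "1 \<le> p" "p \<le> 2"
  shows "frob A \<le> (schatten_norm p A)\<^sup>2"
proof -
  obtain s where s: "singular_value_mset A = image_mset s (mset [0..<n])"
    "frob A = (\<Sum>i<n. (s i)\<^sup>2)" "\<And>i::nat. 0 \<le> (s i :: real)"
    using frob_eq_sum_singular_values[OF A] by blast
  obtain q where q: "p = ereal q" using p by (cases p) auto
  have q12: "1 \<le> q" "q \<le> 2" using p unfolding q by (simp_all add: one_ereal_def numeral_eq_ereal)
  have "schatten_norm p A = (\<Sum>i<n. s i powr q) powr (1 / q)"
    unfolding schatten_norm_def q s(1) sum_mset_upt by simp
  then show ?thesis using sum_squares_le_p_norm[OF s(3) q12, where n = n] s(2) by simp
qed

text \<open>For finite \<open>p\<close> the exponent \<open>1 - 2 / p\<close> is twice the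
  nonnegative \<open>1 / 2 - 1 / p\<close>, so for \<open>n\<close> at least \<open>1\<close> the
  corresponding power of \<open>n\<close> is the larger one.\<close>

lemma frob_le_schatten_norm_dim:
  assumes A: "A \<in> carrier_mat n n" and p: "2 \<le> p"
  shows "frob A \<le> 2 * (schatten_norm p A / real n powr real_of_ereal (2 / p - 1))\<^sup>2"
proof (cases "n = 0")
  case True
  then show ?thesis using A by (simp add: frob_def)
next
  case False
  obtain s where s: "singular_value_mset A = image_mset s (mset [0..<n])"
    "frob A = (\<Sum>i<n. (s i)\<^sup>2)" "\<And>i::nat. 0 \<le> (s i :: real)"
    using frob_eq_sum_singular_values[OF A] by blast
  have n: "1 \<le> real n" using False by simp
  show ?thesis
  proof (cases p)
    case (real q)
    then have q2: "2 \<le> q" using p by (simp add: numeral_eq_ereal)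
    have "schatten_norm p A = (\<Sum>i<n. s i powr q) powr (1 / q)"
      unfolding schatten_norm_def real s(1) sum_mset_upt by simp
    then have frob_le: "frob A \<le> 2 * (real n powr (1 / 2 - 1 / q) * schatten_norm p A)\<^sup>2"
      using sum_squares_le_p_norm_dim[OF s(3) q2, where n = n] s(2) by simp
    have n_eq: "real n powr (1 - 2 / q) = 1 / real n powr real_of_ereal (2 / p - 1)"
    proof -
      have "2 / p - 1 = ereal (2 / q - 1)"
        using q2 unfolding real by (simp add: numeral_eq_ereal one_ereal_def)
      then show ?thesis using powr_minus_divide[of "real n" "2 / q - 1"] by simp
    qed
    have "real n powr (1 / 2 - 1 / q) \<le> real n powr (1 - 2 / q)"
      using n q2 by (intro powr_mono) (auto simp: field_simps)
    from mult_right_mono[OF this schatten_norm_nonneg[of p A]]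
    have "real n powr (1 / 2 - 1 / q) * schatten_norm p A \<le> schatten_norm p A / real n powr real_of_ereal (2 / p - 1)"
      unfolding n_eq by simp
    from power_mono[OF this, of 2]
    have "(real n powr (1 / 2 - 1 / q) * schatten_norm p A)\<^sup>2 \<le> (schatten_norm p A / real n powr real_of_ereal (2 / p - 1))\<^sup>2"
      by (simp only: schatten_norm_nonneg powr_ge_zero mult_nonneg_nonneg simp_thms)
    with frob_le show ?thesis by linarith
  next
    case PInf
    let ?M = "schatten_norm p A"
    have M: "?M = Max (insert 0 (set_mset (singular_value_mset A)))" by (simp add: schatten_norm_def PInf)
    have le: "s i \<le> ?M" if "i < n" for i
      unfolding M s(1) using that by (intro Max_ge) auto
    \<comment> \<open>As \<open>2 / \<infinity> = 0\<close>, the power of \<open>n\<close> is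
      \<open>1 / n\<close> here, and the target is \<open>2 * (?M * n)\<^sup>2\<close>.\<close>
    have "frob A \<le> (\<Sum>i<n. ?M\<^sup>2)"
      unfolding s(2) by (intro sum_mono power_mono) (auto simp: le s(3))
    also have "\<dots> = real n * ?M\<^sup>2" by simp
    also have "\<dots> \<le> (real n)\<^sup>2 * ?M\<^sup>2" using n by (intro mult_right_mono) (auto simp: power2_eq_square)
    also have "\<dots> \<le> 2 * (?M * real n)\<^sup>2" by (simp add: power_mult_distrib)
    finally show ?thesis using n by (simp add: PInf powr_minus_divide)
  qed (use p in auto)
qed

lemma frob_tendsto_0_of_schatten:
  assumes Y: "\<And>n. Y n \<in> carrier_mat n n"
    and o: "(\<exists>p::ereal. 1 \<le> p \<and> p \<le> 2 \<and> (\<lambda>n. schatten_norm p (Y n)) \<in> o(\<lambda>n. 1))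
       \<or> (\<exists>p::ereal. 2 \<le> p \<and> p \<le> \<infinity> \<and>
            (\<lambda>n. schatten_norm p (Y n)) \<in> o(\<lambda>n. real n powr real_of_ereal (2 / p - 1)))"
  shows "(\<lambda>n. frob (Y n)) \<longlonglongrightarrow> 0"
  using o
proof (elim disjE exE conjE)
  fix p :: ereal assume p: "1 \<le> p" "p \<le> 2" and o: "(\<lambda>n. schatten_norm p (Y n)) \<in> o(\<lambda>n. 1)"
  have "(\<lambda>n. (schatten_norm p (Y n))\<^sup>2) \<longlonglongrightarrow> 0\<^sup>2"
    using smalloD_tendsto[OF o] by (intro tendsto_power) simp
  then have lim: "(\<lambda>n. (schatten_norm p (Y n))\<^sup>2) \<longlonglongrightarrow> 0" by simp
  show ?thesis
    by (rule tendsto_sandwich[OF _ _ tendsto_const lim])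
      (intro always_eventually allI frob_nonneg frob_le_schatten_norm[OF Y p])+
next
  fix p :: ereal assume p: "2 \<le> p"
    and o: "(\<lambda>n. schatten_norm p (Y n)) \<in> o(\<lambda>n. real n powr real_of_ereal (2 / p - 1))"
  have "(\<lambda>n. 2 * (schatten_norm p (Y n) / real n powr real_of_ereal (2 / p - 1))\<^sup>2) \<longlonglongrightarrow> 2 * 0\<^sup>2"
    using smalloD_tendsto[OF o] by (intro tendsto_intros)
  then have lim: "(\<lambda>n. 2 * (schatten_norm p (Y n) / real n powr real_of_ereal (2 / p - 1))\<^sup>2) \<longlonglongrightarrow> 0" by simp
  show ?thesis
    by (rule tendsto_sandwich[OF _ _ tendsto_const lim])
      (intro always_eventually allI frob_nonneg frob_le_schatten_norm_dim[OF Y p])+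
qed

section \<open>Counting eigenvalues in discs\<close>

text \<open>A rank factorisation: expand the columns of \<open>R\<close> in a basis of the column
  space. The coefficient of each basis vector in \<open>R *\<^sub>v x\<close> is a linear functional
  of \<open>x\<close>.\<close>

lemma rank_functionals:
  fixes R :: "complex mat"
  assumes R: "R \<in> carrier_mat n nc"
  obtains qs where "length qs = vec_space.rank n R" "set qs \<subseteq> carrier_vec nc"
    "\<forall>x\<in>carrier_vec nc. (\<forall>q\<in>set qs. q \<bullet> x = 0) \<longrightarrow> R *\<^sub>v x = 0\<^sub>v n"
proof -
  interpret vec_space "TYPE(complex)" n .
  let ?C = "set (cols R)"
  have C: "?C \<subseteq> carrier_vec n" using cols_dim[of R] R by auto
  have sub: "subspace class_ring (span ?C) V" using span_is_subspace[of ?C] C by auto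
  have vs: "vectorspace class_ring (span_vs ?C)" using subspace_is_vs[OF sub] .
  have fd: "vectorspace.fin_dim class_ring (span_vs ?C)" using fin_dim_span_cols[OF R] .
  obtain \<beta> where \<beta>: "finite \<beta>" "vectorspace.basis class_ring (span_vs ?C) \<beta>"
    using vectorspace.finite_basis_exists[OF vs fd] by blast
  have card: "card \<beta> = rank R"
    using vectorspace.dim_basis[OF vs \<beta>] by (simp add: rank_def)
  have \<beta>sub: "\<beta> \<subseteq> span ?C" and gen: "LinearCombinations.module.span class_ring (span_vs ?C) \<beta> = span ?C"
    using \<beta>(2) unfolding vectorspace.basis_def[OF vs] by auto
  have \<beta>C: "\<beta> \<subseteq> carrier_vec n" using \<beta>sub span_is_subset2[of ?C] C by auto
  \<comment> \<open>\<open>\<beta>\<close> spans inside the column space; the span in the ambient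
    space is the same.\<close>
  have "span \<beta> = span ?C"
    using span_li_not_depend(1)[OF \<beta>sub] gen sub by (simp add: subspace_def)
  then have "?C \<subseteq> span \<beta>" using in_own_span[of ?C] C by auto
  moreover have "col R j \<in> ?C" if "j < nc" for j using R that by (simp add: cols_def)
  ultimately have "\<forall>j<nc. col R j \<in> span \<beta>" by blast
  then have "\<forall>j<nc. \<exists>a. col R j = lincomb a \<beta>"
    unfolding finite_span[OF \<beta>(1) \<beta>C] by blast
  then obtain a where a: "\<And>j. j < nc \<Longrightarrow> col R j = lincomb (a j) \<beta>" by metis
  obtain xs where xs: "set xs = \<beta>" "distinct xs" using finite_distinct_list[OF \<beta>(1)] by blast
  \<comment> \<open>One functional per basis vector \<open>b\<close>, listing the coefficients of
    \<open>b\<close> in the columns of \<open>R\<close>.\<close>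
  define qs where "qs = map (\<lambda>b. vec nc (\<lambda>j. a j b)) xs"
  have "length qs = rank R" using xs card distinct_card[of xs] by (simp add: qs_def)
  moreover have "set qs \<subseteq> carrier_vec nc" by (auto simp: qs_def)
  moreover have "R *\<^sub>v x = 0\<^sub>v n" if x: "x \<in> carrier_vec nc" and q: "\<forall>q\<in>set qs. q \<bullet> x = 0" for x
  proof (rule eq_vecI)
    fix i assume "i < dim_vec (0\<^sub>v n)"
    then have i: "i < n" by simp
    have "(R *\<^sub>v x) $ i = (\<Sum>j<nc. col R j $ i * x $ j)"
      using R x i by (simp add: scalar_prod_def atLeast0LessThan)
    also have "\<dots> = (\<Sum>j<nc. (\<Sum>b\<in>\<beta>. a j b * b $ i) * x $ j)"
      using a lincomb_index[OF i \<beta>C] by (intro sum.cong refl) simp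
    also have "\<dots> = (\<Sum>b\<in>\<beta>. b $ i * (\<Sum>j<nc. a j b * x $ j))"
      unfolding sum_distrib_right sum_distrib_left by (subst sum.swap) (simp add: mult_ac)
    also have "\<dots> = 0"
    proof (intro sum.neutral ballI)
      fix b assume "b \<in> \<beta>"
      then have "vec nc (\<lambda>j. a j b) \<bullet> x = 0" using q xs by (auto simp: qs_def)
      then have "(\<Sum>j<nc. a j b * x $ j) = 0" using x by (simp add: scalar_prod_def atLeast0LessThan)
      then show "b $ i * (\<Sum>j<nc. a j b * x $ j) = 0" by simp
    qed
    finally show "(R *\<^sub>v x) $ i = 0\<^sub>v n $ i" using i by simp
  qed (use R in auto)
  ultimately show ?thesis using that by blast
qed

text \<open>Padding the fewer than \<open>n\<close> conditions with zero rows gives a square matrix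
  with a zero row, hence a singular one.\<close>

lemma exists_common_kernel_vec:
  fixes qs :: "complex vec list"
  assumes qs: "set qs \<subseteq> carrier_vec n" and len: "length qs < n"
  obtains x where "x \<in> carrier_vec n" "x \<noteq> 0\<^sub>v n" "\<forall>q\<in>set qs. q \<bullet> x = 0"
proof -
  define rs where "rs = qs @ replicate (n - length qs) (0\<^sub>v n)"
  have rs: "set rs \<subseteq> carrier_vec n" "length rs = n" using qs len by (auto simp: rs_def)
  define M where "M = mat_of_rows n rs"
  have M: "M \<in> carrier_mat n n" using mat_of_rows_carrier(1)[of n rs] rs(2) by (simp add: M_def)
  have row: "row M i = rs ! i" if "i < n" for i
    using that rs nth_mem[of i rs] unfolding M_def by (intro mat_of_rows_row) auto
  have last: "row M (n - 1) = 0\<^sub>v n"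
    using len by (subst row) (auto simp: rs_def nth_append)
  have "M = mat\<^sub>r n n (\<lambda>i. if i = n - 1 then 0\<^sub>v n else row M i)"
    using M last by (intro eq_rowI) auto
  then have "det M = 0"
    using det_row_0[of "n - 1" n "row M"] len M by (auto simp: Pi_def)
  then obtain x where x: "x \<in> carrier_vec n" "x \<noteq> 0\<^sub>v n" "M *\<^sub>v x = 0\<^sub>v n"
    using det_0_iff_vec_prod_zero[OF M] by blast
  have "q \<bullet> x = 0" if q: "q \<in> set qs" for q
  proof -
    obtain i where i: "i < length qs" "q = qs ! i" using q by (auto simp: in_set_conv_nth)
    then have "q = row M i" using len by (subst row) (auto simp: rs_def nth_append)
    then have "q \<bullet> x = (M *\<^sub>v x) $ i" using i len M by simp
    then show ?thesis using i len x by simp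
  qed
  then show ?thesis using that x by blast
qed

section \<open>Comparing disc counts of two normal matrices\<close>

text \<open>In the orthonormal eigenbasis, \<open>A\<close> shifted by \<open>c\<close> multiplies
  the \<open>k\<close>-th coordinate of \<open>x\<close> by \<open>a k - c\<close>.\<close>

lemma vnorm_shift_spectral:
  assumes V: "is_unitary n V" and A: "A \<in> carrier_mat n n"
    and AV: "A * V = V * mat n n (\<lambda>(i,j). if i = j then a i else 0)" and x: "x \<in> carrier_vec n"
  shows "(vnorm (A *\<^sub>v x - c \<cdot>\<^sub>v x))\<^sup>2 = (\<Sum>k<n. (cmod (a k - c))\<^sup>2 * (cmod ((mat_adjoint V *\<^sub>v x) $ k))\<^sup>2)"
proof -
  note v = is_unitaryD[OF V]
  let ?D = "mat n n (\<lambda>(i,j). if i = j then a i else 0)"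
  have D: "?D \<in> carrier_mat n n" by simp
  define z where "z = mat_adjoint V *\<^sub>v x"
  have z: "z \<in> carrier_vec n" unfolding z_def by (rule mult_mat_vec_carrier[OF v(2) x])
  have Dz: "?D *\<^sub>v z \<in> carrier_vec n" by (rule mult_mat_vec_carrier[OF D z])
  have xz: "x = V *\<^sub>v z"
    unfolding z_def assoc_mult_mat_vec[OF v(1,2) x, symmetric] v(4) using x by simp
  have "A *\<^sub>v x = (A * V) *\<^sub>v z"
    unfolding xz by (rule assoc_mult_mat_vec[OF A v(1) z, symmetric])
  also have "\<dots> = V *\<^sub>v (?D *\<^sub>v z)"
    unfolding AV by (rule assoc_mult_mat_vec[OF v(1) D z])
  finally have Ax: "A *\<^sub>v x = V *\<^sub>v (?D *\<^sub>v z)" .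
  have cx: "c \<cdot>\<^sub>v x = V *\<^sub>v (c \<cdot>\<^sub>v z)"
    unfolding xz by (rule mult_mat_vec[OF v(1) z, symmetric])
  have "A *\<^sub>v x - c \<cdot>\<^sub>v x = V *\<^sub>v (?D *\<^sub>v z - c \<cdot>\<^sub>v z)"
    unfolding Ax cx using z by (intro mult_minus_distrib_mat_vec[OF v(1) Dz, symmetric]) simp
  then have "vnorm (A *\<^sub>v x - c \<cdot>\<^sub>v x) = vnorm (?D *\<^sub>v z - c \<cdot>\<^sub>v z)"
    using vnorm_unitary[OF V] Dz z by simp
  moreover have "(?D *\<^sub>v z - c \<cdot>\<^sub>v z) $ k = (a k - c) * z $ k" if k: "k < n" for k
  proof -
    have "(?D *\<^sub>v z) $ k = (\<Sum>i<n. (if k = i then a k else 0) * z $ i)"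
      using k z by (simp add: scalar_prod_def atLeast0LessThan)
    also have "\<dots> = a k * z $ k" using k by (simp add: mult_delta_left)
    finally show ?thesis using k z by (simp add: algebra_simps del: index_mult_mat_vec)
  qed
  ultimately show ?thesis
    using z unfolding z_def[symmetric]
    by (simp add: vnorm_sq norm_mult power_mult_distrib del: index_minus_vec(1))
qed

text \<open>Otherwise some nonzero \<open>x\<close> annihilated by all \<open>q\<close> lies both in the span of the eigenvectors of \<open>B\<close> to
  eigenvalues within \<open>s\<close> of \<open>c\<close> and in the span of those of \<open>A\<close> to eigenvalues farther than
  \<open>s + \<delta>\<close> from \<open>c\<close>.\<close>

theorem disc_count_le:
  fixes A B :: "complex mat"
  assumes A: "A \<in> carrier_mat n n" and V: "is_unitary n V" and AV: "A * V = V * mat n n (\<lambda>(i,j). if i = j then a i else 0)"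
    and B: "B \<in> carrier_mat n n" and U: "is_unitary n U" and BU: "B * U = U * mat n n (\<lambda>(i,j). if i = j then b i else 0)"
    and qs: "set qs \<subseteq> carrier_vec n"
    and close: "\<And>x. x \<in> carrier_vec n \<Longrightarrow> \<forall>q\<in>set qs. q \<bullet> x = 0 \<Longrightarrow> vnorm (A *\<^sub>v x - B *\<^sub>v x) \<le> \<delta> * vnorm x"
    and s: "0 \<le> s" and \<delta>: "0 \<le> \<delta>"
  shows "card {j. j < n \<and> cmod (b j - c) \<le> s} \<le> card {k. k < n \<and> cmod (a k - c) \<le> s + \<delta>} + length qs"
proof (rule ccontr)
  let ?J = "{j. j < n \<and> cmod (b j - c) \<le> s}" and ?K = "{k. k < n \<and> cmod (a k - c) \<le> s + \<delta>}"
  let ?J' = "{j. j < n \<and> \<not> cmod (b j - c) \<le> s}"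
  assume "\<not> ?thesis"
  then have less: "card ?K + length qs < card ?J" by simp
  note u = is_unitaryD[OF U] and v = is_unitaryD[OF V]
  have "card ?J + card ?J' = card (?J \<union> ?J')" by (intro card_Un_disjoint[symmetric]) auto
  also have "?J \<union> ?J' = {..<n}" by auto
  finally have J': "card ?J + card ?J' = n" by simp
  \<comment> \<open>These conditions kill the coordinates of \<open>x\<close> in the eigenbasis of
    \<open>B\<close> outside the small disc and in that of \<open>A\<close> inside the large disc,
    and impose every \<open>q\<close>. There are \<open>n - card ?J + card ?K + length qs\<close> of
    them, fewer than \<open>n\<close>.\<close>
  define rs where "rs = map (row (mat_adjoint U)) (sorted_list_of_set ?J')
     @ map (row (mat_adjoint V)) (sorted_list_of_set ?K) @ qs"
  have "set rs \<subseteq> carrier_vec n" using qs u v unfolding rs_def by auto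
  moreover have "length rs < n" using less J' by (simp add: rs_def)
  ultimately obtain x where x: "x \<in> carrier_vec n" "x \<noteq> 0\<^sub>v n" "\<forall>q\<in>set rs. q \<bullet> x = 0"
    by (rule exists_common_kernel_vec)
  define y z where "y = mat_adjoint U *\<^sub>v x" and "z = mat_adjoint V *\<^sub>v x"
  have y: "y \<in> carrier_vec n" unfolding y_def by (rule mult_mat_vec_carrier[OF u(2) x(1)])
  have z: "z \<in> carrier_vec n" unfolding z_def by (rule mult_mat_vec_carrier[OF v(2) x(1)])
  have yn: "vnorm y = vnorm x" and zn: "vnorm z = vnorm x"
    unfolding y_def z_def using vnorm_unitary[OF is_unitary_adjoint] U V x(1) by blast+
  have y0: "y $ j = 0" if "j < n" "\<not> cmod (b j - c) \<le> s" for j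
    using x(3) that u(2) x(1) by (auto simp: rs_def y_def)
  have z0: "z $ k = 0" if "k < n" "cmod (a k - c) \<le> s + \<delta>" for k
    using x(3) that v(2) x(1) by (auto simp: rs_def z_def)
  have Ax: "A *\<^sub>v x \<in> carrier_vec n" and Bx: "B *\<^sub>v x \<in> carrier_vec n" and cx: "c \<cdot>\<^sub>v x \<in> carrier_vec n"
    using A B x(1) by (auto intro: mult_mat_vec_carrier)
  have "(vnorm (B *\<^sub>v x - c \<cdot>\<^sub>v x))\<^sup>2 = (\<Sum>k<n. (cmod (b k - c))\<^sup>2 * (cmod (y $ k))\<^sup>2)"
    unfolding y_def by (rule vnorm_shift_spectral[OF U B BU x(1)])
  also have "\<dots> \<le> (\<Sum>k<n. s\<^sup>2 * (cmod (y $ k))\<^sup>2)"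
  proof (intro sum_mono)
    fix k assume "k \<in> {..<n}"
    then show "(cmod (b k - c))\<^sup>2 * (cmod (y $ k))\<^sup>2 \<le> s\<^sup>2 * (cmod (y $ k))\<^sup>2"
      using y0[of k] by (cases "cmod (b k - c) \<le> s") (auto intro!: mult_right_mono power_mono)
  qed
  also have "\<dots> = (s * vnorm x)\<^sup>2"
    unfolding yn[symmetric] using y by (simp add: vnorm_sq sum_distrib_left power_mult_distrib)
  finally have le: "vnorm (B *\<^sub>v x - c \<cdot>\<^sub>v x) \<le> s * vnorm x"
    by (rule power2_le_imp_le) (use s in simp)
  \<comment> \<open>A nonzero coordinate, necessarily outside the large disc, makes the lower bound
    for \<open>A\<close> strict.\<close>
  have "\<exists>k<n. z $ k \<noteq> 0"
  proof (rule ccontr)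
    assume "\<not> ?thesis"
    then have "vnorm z = 0" using z by (simp add: vnorm_def L2_set_def)
    then show False using vnorm_pos[OF x(1,2)] zn by simp
  qed
  then obtain k0 where k0: "k0 < n" "z $ k0 \<noteq> 0" by blast
  have "((s + \<delta>) * vnorm x)\<^sup>2 = (\<Sum>k<n. (s + \<delta>)\<^sup>2 * (cmod (z $ k))\<^sup>2)"
    unfolding zn[symmetric] using z by (simp add: vnorm_sq sum_distrib_left power_mult_distrib)
  also have "\<dots> < (\<Sum>k<n. (cmod (a k - c))\<^sup>2 * (cmod (z $ k))\<^sup>2)"
  proof (rule sum_strict_mono_ex1)
    show "\<forall>k\<in>{..<n}. (s + \<delta>)\<^sup>2 * (cmod (z $ k))\<^sup>2 \<le> (cmod (a k - c))\<^sup>2 * (cmod (z $ k))\<^sup>2"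
    proof
      fix k assume "k \<in> {..<n}"
      then show "(s + \<delta>)\<^sup>2 * (cmod (z $ k))\<^sup>2 \<le> (cmod (a k - c))\<^sup>2 * (cmod (z $ k))\<^sup>2"
        using z0[of k] s \<delta> by (cases "cmod (a k - c) \<le> s + \<delta>") (auto intro!: mult_right_mono power_mono)
    qed
    have "s + \<delta> < cmod (a k0 - c)" using z0[of k0] k0 by force
    then have "(s + \<delta>)\<^sup>2 < (cmod (a k0 - c))\<^sup>2" using s \<delta> by (intro power_strict_mono) auto
    then have "(s + \<delta>)\<^sup>2 * (cmod (z $ k0))\<^sup>2 < (cmod (a k0 - c))\<^sup>2 * (cmod (z $ k0))\<^sup>2"
      using k0(2) by (intro mult_strict_right_mono) auto
    then show "\<exists>k\<in>{..<n}. (s + \<delta>)\<^sup>2 * (cmod (z $ k))\<^sup>2 < (cmod (a k - c))\<^sup>2 * (cmod (z $ k))\<^sup>2"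
      using k0(1) by auto
  qed simp
  also have "\<dots> = (vnorm (A *\<^sub>v x - c \<cdot>\<^sub>v x))\<^sup>2"
    unfolding z_def by (rule vnorm_shift_spectral[OF V A AV x(1), symmetric])
  finally have gt: "(s + \<delta>) * vnorm x < vnorm (A *\<^sub>v x - c \<cdot>\<^sub>v x)"
    by (rule power2_less_imp_less) simp
  \<comment> \<open>By the triangle inequality the left side has norm at most
    \<open>(\<delta> + s) * vnorm x\<close>, contradicting \<open>gt\<close>.\<close>
  have "A *\<^sub>v x - c \<cdot>\<^sub>v x = (A *\<^sub>v x - B *\<^sub>v x) + (B *\<^sub>v x - c \<cdot>\<^sub>v x)"
    using A B cx by (intro eq_vecI) (auto simp del: index_mult_mat_vec)
  then have "vnorm (A *\<^sub>v x - c \<cdot>\<^sub>v x) \<le> vnorm (A *\<^sub>v x - B *\<^sub>v x) + vnorm (B *\<^sub>v x - c \<cdot>\<^sub>v x)"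
    using vnorm_add_le[of "A *\<^sub>v x - B *\<^sub>v x" n "B *\<^sub>v x - c \<cdot>\<^sub>v x"] Ax Bx cx by simp
  moreover have "vnorm (A *\<^sub>v x - B *\<^sub>v x) \<le> \<delta> * vnorm x"
    using x(3) by (intro close x(1)) (auto simp: rs_def)
  ultimately show False using gt le by (simp add: algebra_simps)
qed

section \<open>From disc counts to averages\<close>

lemma integrable_mult_indicator_cball:
  fixes F :: "complex \<Rightarrow> real"
  assumes F: "continuous_on UNIV F"
  shows "integrable lborel (\<lambda>c. F c * indicator (cball x t) c)"
  using borel_integrable_compact[OF compact_cball continuous_on_subset[OF F subset_UNIV], of x t]
  by (simp add: mult.commute)

lemma integrable_bounded_support:
  fixes F :: "complex \<Rightarrow> real"
  assumes F: "continuous_on UNIV F" and b: "bounded {z. F z \<noteq> 0}"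
  shows "integrable lborel F"
proof -
  obtain x t where "{z. F z \<noteq> 0} \<subseteq> cball x t" using b by (meson bounded_subset_cball)
  then have "(\<lambda>c. F c * indicator (cball x t) c) = F"
    by (auto simp: fun_eq_iff indicator_def)
  then show ?thesis using integrable_mult_indicator_cball[OF F, of x t] by simp
qed

text \<open>Up to the oscillation \<open>e\<close>, the value at \<open>x\<close> is the mean of
  \<open>F\<close> over the disc around \<open>x\<close>; this turns point values into
  integrals.\<close>

lemma integral_cball_approx:
  fixes F :: "complex \<Rightarrow> real"
  assumes F: "continuous_on UNIV F" and e: "\<And>y. dist x y \<le> t \<Longrightarrow> \<bar>F x - F y\<bar> \<le> e"
  shows "(F x - e) * measure lborel (cball x t) \<le> (\<integral>c. F c * indicator (cball x t) c \<partial>lborel)"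
    and "(\<integral>c. F c * indicator (cball x t) c \<partial>lborel) \<le> (F x + e) * measure lborel (cball x t)"
proof -
  have int: "integrable lborel (\<lambda>c. k * indicator (cball x t) c)" for k :: real
    by (intro integrable_mult_right integrable_real_indicator) (auto simp: emeasure_lborel_cball_finite[unfolded infinity_ennreal_def])
  have val: "(\<integral>c. k * indicator (cball x t) c \<partial>lborel) = k * measure lborel (cball x t)" for k :: real
    by simp
  have ab: "F x - e \<le> F c" "F c \<le> F x + e" if "c \<in> cball x t" for c
    using e[of c] that by auto
  show "(F x - e) * measure lborel (cball x t) \<le> (\<integral>c. F c * indicator (cball x t) c \<partial>lborel)"
    unfolding val[symmetric]
    by (intro integral_mono int integrable_mult_indicator_cball F) (auto simp: indicator_def ab)
  show "(\<integral>c. F c * indicator (cball x t) c \<partial>lborel) \<le> (F x + e) * measure lborel (cball x t)"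
    unfolding val[symmetric]
    by (intro integral_mono int integrable_mult_indicator_cball F) (auto simp: indicator_def ab)
qed

lemma measure_cball_complex:
  "0 \<le> t \<Longrightarrow> measure lborel (cball (x::complex) t) = unit_ball_vol 2 * t\<^sup>2"
  using content_cball[of t x] by simp

text \<open>Being in the disc around \<open>b j\<close> is symmetric in \<open>c\<close> and
  \<open>b j\<close>, so summing the indicators counts the points within \<open>t\<close> of
  \<open>c\<close>.\<close>

lemma sum_integral_cball:
  fixes F :: "complex \<Rightarrow> real" and b :: "nat \<Rightarrow> complex"
  assumes F: "continuous_on UNIV F"
  shows "(\<Sum>j<n. \<integral>c. F c * indicator (cball (b j) t) c \<partial>lborel)
      = (\<integral>c. F c * real (card {j. j < n \<and> cmod (b j - c) \<le> t}) \<partial>lborel)"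
    and "integrable lborel (\<lambda>c. F c * real (card {j. j < n \<and> cmod (b j - c) \<le> t}))"
proof -
  have eq: "F c * real (card {j. j < n \<and> cmod (b j - c) \<le> t}) = (\<Sum>j<n. F c * indicator (cball (b j) t) c)" for c
  proof -
    have "(\<Sum>j<n. indicator (cball (b j) t) c :: real) = (\<Sum>j\<in>{j. j < n \<and> cmod (b j - c) \<le> t}. 1)"
      by (intro sum.mono_neutral_cong_right[OF finite_lessThan]) (auto simp: indicator_def dist_norm)
    then show ?thesis by (simp add: sum_distrib_left[symmetric])
  qed
  show "(\<Sum>j<n. \<integral>c. F c * indicator (cball (b j) t) c \<partial>lborel)
      = (\<integral>c. F c * real (card {j. j < n \<and> cmod (b j - c) \<le> t}) \<partial>lborel)"
    unfolding eq by (intro Bochner_Integration.integral_sum[symmetric] integrable_mult_indicator_cball F)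
  show "integrable lborel (\<lambda>c. F c * real (card {j. j < n \<and> cmod (b j - c) \<le> t}))"
    unfolding eq by (intro Bochner_Integration.integrable_sum integrable_mult_indicator_cball F)
qed

text \<open>Each \<open>F (b j)\<close> is replaced by its mean over a disc of radius
  \<open>s\<close>, the counts are compared under the integral (where \<open>F \<ge> 0\<close>
  enters), and discs of radius \<open>s + d\<close> lead back to \<open>F (a k)\<close>. The squared
  quotient is the ratio of the disc areas; the surplus \<open>r\<close> costs \<open>r\<close>
  integrals of \<open>F\<close> per area of the small disc.\<close>

lemma sum_le_of_disc_count:
  fixes F :: "complex \<Rightarrow> real" and a b :: "nat \<Rightarrow> complex"
  assumes F: "continuous_on UNIV F" "bounded {z. F z \<noteq> 0}" "\<And>z. 0 \<le> F z"
    and s: "0 < s" and d: "0 \<le> d"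
    and e: "\<And>x y. dist x y \<le> s + d \<Longrightarrow> \<bar>F x - F y\<bar> \<le> e"
    and count: "\<And>c. card {j. j < n \<and> cmod (b j - c) \<le> s} \<le> card {k. k < n \<and> cmod (a k - c) \<le> s + d} + r"
  shows "(\<Sum>j<n. F (b j)) \<le> real n * e + ((s + d) / s)\<^sup>2 * ((\<Sum>k<n. F (a k)) + real n * e)
    + real r * ((\<integral>c. F c \<partial>lborel) / (unit_ball_vol 2 * s\<^sup>2))"
proof -
  define \<kappa> :: real where "\<kappa> = unit_ball_vol 2"
  have \<kappa>: "0 < \<kappa>" by (simp add: \<kappa>_def)
  have ms: "measure lborel (cball x s) = \<kappa> * s\<^sup>2" for x :: complex
    using s by (simp add: measure_cball_complex \<kappa>_def)
  have md: "measure lborel (cball x (s + d)) = \<kappa> * (s + d)\<^sup>2" for x :: complex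
    using s d by (simp add: measure_cball_complex \<kappa>_def)
  note int = integrable_bounded_support[OF F(1,2)]
  have "\<kappa> * s\<^sup>2 * ((\<Sum>j<n. F (b j)) - real n * e) = (\<Sum>j<n. (F (b j) - e) * measure lborel (cball (b j) s))"
    by (simp add: ms sum_distrib_right[symmetric] sum_subtractf)
  also have "\<dots> \<le> (\<Sum>j<n. \<integral>c. F c * indicator (cball (b j) s) c \<partial>lborel)"
    using d by (intro sum_mono integral_cball_approx(1)[OF F(1)] e) auto
  also have "\<dots> = (\<integral>c. F c * real (card {j. j < n \<and> cmod (b j - c) \<le> s}) \<partial>lborel)"
    by (rule sum_integral_cball(1)[OF F(1)])
  also have "\<dots> \<le> (\<integral>c. F c * real (card {k. k < n \<and> cmod (a k - c) \<le> s + d}) + real r * F c \<partial>lborel)"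
  proof (intro integral_mono)
    fix c
    have "F c * real (card {j. j < n \<and> cmod (b j - c) \<le> s}) \<le> F c * real (card {k. k < n \<and> cmod (a k - c) \<le> s + d} + r)"
      using count[of c] by (intro mult_left_mono F(3) of_nat_mono)
    then show "F c * real (card {j. j < n \<and> cmod (b j - c) \<le> s})
        \<le> F c * real (card {k. k < n \<and> cmod (a k - c) \<le> s + d}) + real r * F c"
      by (simp add: algebra_simps)
  qed (intro sum_integral_cball(2)[OF F(1)] Bochner_Integration.integrable_add integrable_mult_right int)+
  also have "\<dots> = (\<integral>c. F c * real (card {k. k < n \<and> cmod (a k - c) \<le> s + d}) \<partial>lborel) + real r * (\<integral>c. F c \<partial>lborel)"
    by (subst Bochner_Integration.integral_add) (auto intro!: sum_integral_cball(2)[OF F(1)] integrable_mult_right int)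
  also have "(\<integral>c. F c * real (card {k. k < n \<and> cmod (a k - c) \<le> s + d}) \<partial>lborel)
      = (\<Sum>k<n. \<integral>c. F c * indicator (cball (a k) (s + d)) c \<partial>lborel)"
    by (rule sum_integral_cball(1)[OF F(1), symmetric])
  also have "\<dots> \<le> (\<Sum>k<n. (F (a k) + e) * measure lborel (cball (a k) (s + d)))"
    by (intro sum_mono integral_cball_approx(2)[OF F(1)] e) auto
  also have "\<dots> = \<kappa> * (s + d)\<^sup>2 * ((\<Sum>k<n. F (a k)) + real n * e)"
    by (simp add: md sum_distrib_right[symmetric] sum.distrib)
  finally have "(\<Sum>j<n. F (b j)) - real n * e
      \<le> (\<kappa> * (s + d)\<^sup>2 * ((\<Sum>k<n. F (a k)) + real n * e) + real r * (\<integral>c. F c \<partial>lborel)) / (\<kappa> * s\<^sup>2)"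
    using \<kappa> s by (simp add: pos_le_divide_eq mult.commute)
  also have "\<dots> = ((s + d) / s)\<^sup>2 * ((\<Sum>k<n. F (a k)) + real n * e) + real r * ((\<integral>c. F c \<partial>lborel) / (\<kappa> * s\<^sup>2))"
    unfolding add_divide_distrib[of _ _ "\<kappa> * s\<^sup>2"] power_divide using \<kappa> by simp
  finally show ?thesis by (simp add: \<kappa>_def)
qed

text \<open>The radius \<open>s\<close> is fixed first, from uniform continuity. As \<open>n\<close>
  grows, the area ratio tends to \<open>1\<close> and the term with \<open>r n / n\<close> to
  \<open>0\<close>.\<close>

lemma eventually_avg_le_of_disc_count:
  fixes F :: "complex \<Rightarrow> real" and a b :: "nat \<Rightarrow> nat \<Rightarrow> complex"
  assumes F: "continuous_on UNIV F" "bounded {z. F z \<noteq> 0}" "\<And>z. 0 \<le> F z"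
    and d: "\<And>n. 0 \<le> d n" "d \<longlonglongrightarrow> 0" and r: "(\<lambda>n. real (r n) / real n) \<longlonglongrightarrow> 0"
    and count: "\<And>n c s. 0 \<le> s \<Longrightarrow> card {j. j < n \<and> cmod (b n j - c) \<le> s} \<le> card {k. k < n \<and> cmod (a n k - c) \<le> s + d n} + r n"
    and \<eta>: "0 < \<eta>"
  shows "eventually (\<lambda>n. (\<Sum>j<n. F (b n j)) / n \<le> (\<Sum>k<n. F (a n k)) / n + \<eta>) sequentially"
proof -
  \<comment> \<open>Two shares pay for the two replacements of values by disc means, the third for
    the vanishing remainder.\<close>
  define e where "e = \<eta> / 3"
  have e: "0 < e" using \<eta> by (simp add: e_def)
  obtain w where w: "0 < w" "\<And>x y. dist x y < w \<Longrightarrow> dist (F x) (F y) < e"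
    using uniform_continuity_bounded_support[OF F(1,2) e] by blast
  obtain M where M: "0 \<le> M" "\<And>x. norm (F x) \<le> M"
    using bounded_range_bounded_support[OF F(1,2)] by blast
  \<comment> \<open>Once \<open>d n < s\<close>, both radii stay below \<open>w\<close>.\<close>
  define s where "s = w / 3"
  have s: "0 < s" using w(1) by (simp add: s_def)
  define I where "I = (\<integral>c. F c \<partial>lborel) / (unit_ball_vol 2 * s\<^sup>2)"
  have "(\<lambda>n. (((s + d n) / s)\<^sup>2 - 1) * (M + e) + real (r n) / real n * I) \<longlonglongrightarrow> (((s + 0) / s)\<^sup>2 - 1) * (M + e) + 0 * I"
    using s by (intro tendsto_intros d r) auto
  then have "(\<lambda>n. (((s + d n) / s)\<^sup>2 - 1) * (M + e) + real (r n) / real n * I) \<longlonglongrightarrow> 0" using s by simp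
  then have "eventually (\<lambda>n. (((s + d n) / s)\<^sup>2 - 1) * (M + e) + real (r n) / real n * I < e) sequentially"
    using e by (rule order_tendstoD)
  moreover have "eventually (\<lambda>n. d n < s) sequentially" using d(2) s by (rule order_tendstoD)
  moreover have "eventually (\<lambda>n. 0 < n) sequentially" by (rule eventually_gt_at_top)
  ultimately show ?thesis
  proof eventually_elim
    case (elim n)
    let ?a = "(\<Sum>k<n. F (a n k)) / n" and ?b = "(\<Sum>j<n. F (b n j)) / n" and ?q = "((s + d n) / s)\<^sup>2"
    have n: "0 < real n" using elim by simp
    have "(\<Sum>j<n. F (b n j)) \<le> real n * e + ?q * ((\<Sum>k<n. F (a n k)) + real n * e) + real (r n) * I"
      unfolding I_def
    proof (rule sum_le_of_disc_count[OF F s d(1)])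
      show "\<bar>F x - F y\<bar> \<le> e" if "dist x y \<le> s + d n" for x y
        using w(2)[of x y] that elim(2) w(1) by (simp add: s_def dist_real_def)
      show "card {j. j < n \<and> cmod (b n j - c) \<le> s} \<le> card {k. k < n \<and> cmod (a n k - c) \<le> s + d n} + r n" for c
        by (rule count) (use s in simp)
    qed
    then have "?b \<le> (real n * e + ?q * ((\<Sum>k<n. F (a n k)) + real n * e) + real (r n) * I) / n"
      using n by (intro divide_right_mono) auto
    also have "\<dots> = e + ?q * (?a + e) + real (r n) / n * I"
      using n by (simp add: add_divide_distrib distrib_left)
    \<comment> \<open>Writing \<open>?q\<close> as \<open>1 + (?q - 1)\<close> isolates the null
      sequence \<open>?q - 1\<close>, whose factor \<open>?a + e\<close> is at most
      \<open>M + e\<close>.\<close>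
    also have "\<dots> = ?a + 2 * e + ((?q - 1) * (?a + e) + real (r n) / n * I)"
      by (simp add: algebra_simps)
    also have "(?q - 1) * (?a + e) \<le> (?q - 1) * (M + e)"
    proof (intro mult_left_mono add_right_mono)
      have "(\<Sum>k<n. F (a n k)) \<le> (\<Sum>k<n. M)" using M(2) by (intro sum_mono) (metis abs_le_D1 real_norm_def)
      then show "?a \<le> M" using n by (simp add: pos_divide_le_eq mult.commute)
      have "1 \<le> (s + d n) / s" using s d(1)[of n] by simp
      then show "0 \<le> ?q - 1" using one_le_power[of "(s + d n) / s" 2] by simp
    qed
    finally have "?b \<le> ?a + 2 * e + ((?q - 1) * (M + e) + real (r n) / n * I)" by simp
    moreover have "\<eta> = 3 * e" by (simp add: e_def)
    ultimately show ?case using elim(1) by linarith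
  qed
qed

text \<open>The two count inequalities give two-sided bounds for nonnegative functions. A complex
  \<open>F\<close> splits into the positive and negative parts of its real and imaginary
  parts.\<close>

theorem avg_diff_tendsto_0_of_disc_count:
  fixes F :: "complex \<Rightarrow> complex" and a b :: "nat \<Rightarrow> nat \<Rightarrow> complex"
  assumes F: "continuous_on UNIV F" "bounded {z. F z \<noteq> 0}"
    and d: "\<And>n. 0 \<le> d n" "d \<longlonglongrightarrow> 0" and r: "(\<lambda>n. real (r n) / real n) \<longlonglongrightarrow> 0"
    and ba: "\<And>n c s. 0 \<le> s \<Longrightarrow> card {j. j < n \<and> cmod (b n j - c) \<le> s} \<le> card {k. k < n \<and> cmod (a n k - c) \<le> s + d n} + r n"
    and ab: "\<And>n c s. 0 \<le> s \<Longrightarrow> card {j. j < n \<and> cmod (a n j - c) \<le> s} \<le> card {k. k < n \<and> cmod (b n k - c) \<le> s + d n} + r n"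
  shows "(\<lambda>n. ((\<Sum>j<n. F (b n j)) - (\<Sum>k<n. F (a n k))) / n) \<longlonglongrightarrow> 0"
proof -
  define L where "L G = (\<lambda>n. ((\<Sum>j<n. G (b n j)) - (\<Sum>k<n. G (a n k))) / real n)" for G :: "complex \<Rightarrow> real"
  have nonneg: "L G \<longlonglongrightarrow> 0"
    if G: "continuous_on UNIV G" "bounded {z. G z \<noteq> 0}" "\<And>z. 0 \<le> G z" for G
  proof (rule LIMSEQ_I)
    fix \<eta> :: real assume \<eta>: "0 < \<eta>"
    then have \<eta>2: "0 < \<eta> / 2" by simp
    from eventually_conj[OF eventually_avg_le_of_disc_count[OF G d r ba \<eta>2] eventually_avg_le_of_disc_count[OF G d r ab \<eta>2]]
    have "eventually (\<lambda>n. norm (L G n - 0) < \<eta>) sequentially"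
      by (rule eventually_mono) (use \<eta> in \<open>auto simp: L_def diff_divide_distrib abs_less_iff\<close>)
    then show "\<exists>no. \<forall>n\<ge>no. norm (L G n - 0) < \<eta>" by (simp add: eventually_sequentially)
  qed
  \<comment> \<open>Here \<open>g\<close> will be plus or minus \<open>Re\<close> or
    \<open>Im\<close>; \<open>g 0 = 0\<close> keeps the support bounded.\<close>
  have part: "L (\<lambda>z. max 0 (g (F z))) \<longlonglongrightarrow> 0"
    if "continuous_on UNIV g" "g 0 = 0" for g :: "complex \<Rightarrow> real"
  proof (rule nonneg)
    show "continuous_on UNIV (\<lambda>z. max 0 (g (F z)))"
      by (intro continuous_intros continuous_on_compose2[OF that(1) F(1)]) auto
    show "bounded {z. max 0 (g (F z)) \<noteq> 0}"
      by (rule bounded_subset[OF F(2)]) (use that(2) in auto)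
  qed simp
  let ?R = "\<lambda>n. L (\<lambda>z. max 0 (Re (F z))) n - L (\<lambda>z. max 0 (- Re (F z))) n"
  let ?I = "\<lambda>n. L (\<lambda>z. max 0 (Im (F z))) n - L (\<lambda>z. max 0 (- Im (F z))) n"
  have "(\<lambda>n. Complex (?R n) (?I n)) \<longlonglongrightarrow> Complex (0 - 0) (0 - 0)"
    by (intro tendsto_Complex tendsto_diff part continuous_intros) auto
  moreover have "Complex (?R n) (?I n) = ((\<Sum>j<n. F (b n j)) - (\<Sum>k<n. F (a n k))) / n" for n
  proof (rule complex_eqI)
    have m: "max 0 x - max 0 (- x) = x" for x :: real by simp
    have R: "?R n = (\<Sum>j<n. max 0 (Re (F (b n j))) - max 0 (- Re (F (b n j)))) / n
        - (\<Sum>j<n. max 0 (Re (F (a n j))) - max 0 (- Re (F (a n j)))) / n"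
      by (simp only: L_def sum_subtractf) (simp add: diff_divide_distrib)
    show "Re (Complex (?R n) (?I n)) = Re (((\<Sum>j<n. F (b n j)) - (\<Sum>k<n. F (a n k))) / n)"
      unfolding complex.sel R m by (simp add: diff_divide_distrib)
    have I: "?I n = (\<Sum>j<n. max 0 (Im (F (b n j))) - max 0 (- Im (F (b n j)))) / n
        - (\<Sum>j<n. max 0 (Im (F (a n j))) - max 0 (- Im (F (a n j)))) / n"
      by (simp only: L_def sum_subtractf) (simp add: diff_divide_distrib)
    show "Im (Complex (?R n) (?I n)) = Im (((\<Sum>j<n. F (b n j)) - (\<Sum>k<n. F (a n k))) / n)"
      unfolding complex.sel I m by (simp add: diff_divide_distrib)
  qed
  ultimately show ?thesis by (simp add: zero_complex.code)
qed

section \<open>Spectral distributions\<close>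

lemma spectral_distribution_transfer:
  assumes X: "spectral_distribution X D f"
    and diff: "\<And>F :: complex \<Rightarrow> complex. continuous_on UNIV F \<Longrightarrow> bounded {z. F z \<noteq> 0} \<Longrightarrow>
      (\<lambda>n. ((\<Sum>z\<in>#eigenvalue_mset (Z n). F z) - (\<Sum>z\<in>#eigenvalue_mset (X n). F z)) / of_nat n) \<longlonglongrightarrow> 0"
  shows "spectral_distribution Z D f"
  unfolding spectral_distribution_def
proof (intro allI impI, elim conjE)
  fix F :: "complex \<Rightarrow> complex"
  assume F: "continuous_on UNIV F" "bounded {z. F z \<noteq> 0}"
  from X F have "(\<lambda>n. (\<Sum>z\<in>#eigenvalue_mset (X n). F z) / of_nat n)
      \<longlonglongrightarrow> integral\<^sup>L (lebesgue_on D) (\<lambda>x. F (f x)) / of_real (measure lebesgue D)"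
    unfolding spectral_distribution_def by blast
  from tendsto_add[OF diff[OF F] this]
  show "(\<lambda>n. (\<Sum>z\<in>#eigenvalue_mset (Z n). F z) / of_nat n)
      \<longlonglongrightarrow> integral\<^sup>L (lebesgue_on D) (\<lambda>x. F (f x)) / of_real (measure lebesgue D)"
    by (simp add: diff_divide_distrib)
qed

text \<open>The factor \<open>n\<close> in the weighted bound cancels against the average over
  \<open>n\<close> eigenvalues. The constant \<open>C\<close> depends on \<open>F\<close> and
  \<open>r\<close> only, so the remainder \<open>C * frob (Y n)\<close> vanishes in the
  limit.\<close>

lemma spectral_distribution_add_frob:
  assumes X: "\<And>n. X n \<in> carrier_mat n n" "\<And>n. normal_mat (X n)" "spectral_distribution X D f"
    and Y: "\<And>n. Y n \<in> carrier_mat n n" "(\<lambda>n. frob (Y n)) \<longlonglongrightarrow> 0"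
  shows "spectral_distribution (\<lambda>n. X n + Y n) D f"
proof (rule spectral_distribution_transfer[OF X(3)])
  fix F :: "complex \<Rightarrow> complex"
  assume F: "continuous_on UNIV F" "bounded {z. F z \<noteq> 0}"
  show "(\<lambda>n. ((\<Sum>z\<in>#eigenvalue_mset (X n + Y n). F z) - (\<Sum>z\<in>#eigenvalue_mset (X n). F z)) / of_nat n) \<longlonglongrightarrow> 0"
  proof (rule LIMSEQ_I)
    fix r :: real assume "0 < r"
    then have r: "0 < r / 2" by simp
    obtain C where C: "0 \<le> C" "\<And>x y. cmod (F x - F y) \<le> r / 2 + C * (cmod (x - y))\<^sup>2"
      using quadratic_modulus_bounded_support[OF F r] by blast
    have bound: "cmod (((\<Sum>z\<in>#eigenvalue_mset (X n + Y n). F z) - (\<Sum>z\<in>#eigenvalue_mset (X n). F z)) / of_nat n)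
        \<le> r / 2 + C * frob (Y n)" if n: "0 < n" for n
    proof -
      obtain W a b where W: "is_unitary n W"
        and ab: "eigenvalue_mset (X n) = image_mset a (mset [0..<n])"
          "eigenvalue_mset (X n + Y n) = image_mset b (mset [0..<n])"
        and le: "(\<Sum>k<n. \<Sum>j<n. (cmod (W $$ (k,j)))\<^sup>2 * (cmod (a k - b j))\<^sup>2) \<le> real n * frob (Y n)"
        by (rule normal_perturbation_weights[OF X(1,2) Y(1)])
      have "cmod ((\<Sum>j<n. F (b j)) - (\<Sum>k<n. F (a k))) \<le> real n * (r / 2) + C * (real n * frob (Y n))"
        by (rule sum_diff_le_of_weights[OF W le C(2,1)])
      then have "cmod ((\<Sum>j<n. F (b j)) - (\<Sum>k<n. F (a k))) / n \<le> r / 2 + C * frob (Y n)"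
        using n by (simp add: field_simps)
      then show ?thesis unfolding ab sum_mset_upt by (simp add: norm_divide)
    qed
    have lim: "(\<lambda>n. r / 2 + C * frob (Y n)) \<longlonglongrightarrow> r / 2 + C * 0"
      by (intro tendsto_intros Y(2))
    have "eventually (\<lambda>n. r / 2 + C * frob (Y n) < r) sequentially"
      using order_tendstoD(2)[OF lim, of r] \<open>0 < r\<close> by simp
    then have "eventually (\<lambda>n. norm (((\<Sum>z\<in>#eigenvalue_mset (X n + Y n). F z) - (\<Sum>z\<in>#eigenvalue_mset (X n). F z)) / of_nat n - 0) < r) sequentially"
      using eventually_gt_at_top[of 0]
    proof eventually_elim
      case (elim n)
      show ?case using bound[OF elim(2)] elim(1) by (simp only: diff_zero)
    qed
    then show "\<exists>no. \<forall>n\<ge>no. norm (((\<Sum>z\<in>#eigenvalue_mset (X n + Y n). F z) - (\<Sum>z\<in>#eigenvalue_mset (X n). F z)) / of_nat n - 0) < r"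
      by (simp only: eventually_sequentially)
  qed
qed

text \<open>On the common kernel of the functionals of \<open>R\<close>, the two normal matrices
  differ by \<open>N\<close> alone. This is symmetric in them, so \<open>disc_count_le\<close>
  applies in both directions.\<close>

lemma disc_count_zero_distributed:
  assumes X: "X \<in> carrier_mat n n" "normal_mat X" and XY: "normal_mat (X + R + N)"
    and RN: "R \<in> carrier_mat n n" "N \<in> carrier_mat n n"
  obtains a b where "eigenvalue_mset X = image_mset a (mset [0..<n])"
    "eigenvalue_mset (X + R + N) = image_mset b (mset [0..<n])"
    "\<forall>s\<ge>0. \<forall>c. card {j. j < n \<and> cmod (b j - c) \<le> s}
       \<le> card {k. k < n \<and> cmod (a k - c) \<le> s + spectral_norm N} + vec_space.rank n R"
    "\<forall>s\<ge>0. \<forall>c. card {j. j < n \<and> cmod (a j - c) \<le> s}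
       \<le> card {k. k < n \<and> cmod (b k - c) \<le> s + spectral_norm N} + vec_space.rank n R"
proof -
  define B where "B = X + R + N"
  have B: "B \<in> carrier_mat n n" using X RN by (simp add: B_def)
  obtain V a where V: "is_unitary n V" "X * V = V * mat n n (\<lambda>(i,j). if i = j then a i else 0)"
    and a: "eigenvalue_mset X = image_mset a (mset [0..<n])"
    by (rule normal_mat_spectral[OF X])
  obtain U b where U: "is_unitary n U" "B * U = U * mat n n (\<lambda>(i,j). if i = j then b i else 0)"
    and b: "eigenvalue_mset B = image_mset b (mset [0..<n])"
    by (rule normal_mat_spectral[OF B XY[folded B_def]])
  obtain qs where qs: "length qs = vec_space.rank n R" "set qs \<subseteq> carrier_vec n"
    "\<forall>x\<in>carrier_vec n. (\<forall>q\<in>set qs. q \<bullet> x = 0) \<longrightarrow> R *\<^sub>v x = 0\<^sub>v n"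
    by (rule rank_functionals[OF RN(1)])
  have close: "vnorm (B *\<^sub>v x - X *\<^sub>v x) \<le> spectral_norm N * vnorm x"
    if x: "x \<in> carrier_vec n" "\<forall>q\<in>set qs. q \<bullet> x = 0" for x
  proof -
    have Rx: "R *\<^sub>v x = 0\<^sub>v n" using qs(3) x by blast
    have Nx: "N *\<^sub>v x \<in> carrier_vec n" and Xx: "X *\<^sub>v x \<in> carrier_vec n"
      using mult_mat_vec_carrier X(1) RN(2) x(1) by blast+
    have "B *\<^sub>v x = X *\<^sub>v x + R *\<^sub>v x + N *\<^sub>v x"
      unfolding B_def
      by (simp only: add_mult_distrib_mat_vec[OF add_carrier_mat[OF RN(1)] RN(2) x(1)]
          add_mult_distrib_mat_vec[OF X(1) RN(1) x(1)])
    then have "B *\<^sub>v x - X *\<^sub>v x = N *\<^sub>v x"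
      unfolding Rx using X(1) RN(2) Nx Xx by (intro eq_vecI) (auto simp del: index_mult_mat_vec)
    then show ?thesis using vnorm_mult_le_spectral_norm[OF RN(2) x(1)] by simp
  qed
  then have close': "vnorm (X *\<^sub>v x - B *\<^sub>v x) \<le> spectral_norm N * vnorm x"
    if x: "x \<in> carrier_vec n" "\<forall>q\<in>set qs. q \<bullet> x = 0" for x
    using that vnorm_minus_commute[of "X *\<^sub>v x" n "B *\<^sub>v x"] mult_mat_vec_carrier[OF X(1) x(1)] mult_mat_vec_carrier[OF B x(1)]
    by simp
  note count = disc_count_le[OF X(1) V B U qs(2) close' _ schatten_norm_nonneg, unfolded qs(1)]
    disc_count_le[OF B U X(1) V qs(2) close _ schatten_norm_nonneg, unfolded qs(1)]
  show ?thesis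
    by (rule that[OF a b[unfolded B_def]]) (use count in blast)+
qed

lemma spectral_distribution_add_zero_distributed:
  assumes X: "\<And>n. X n \<in> carrier_mat n n" "\<And>n. normal_mat (X n)" "spectral_distribution X D f"
    and Y: "zero_distributed Y" "\<And>n. normal_mat (X n + Y n)"
  shows "spectral_distribution (\<lambda>n. X n + Y n) D f"
proof (rule spectral_distribution_transfer[OF X(3)])
  fix F :: "complex \<Rightarrow> complex"
  assume F: "continuous_on UNIV F" "bounded {z. F z \<noteq> 0}"
  obtain R N where RN: "\<And>n. R n \<in> carrier_mat n n" "\<And>n. N n \<in> carrier_mat n n" "\<And>n. Y n = R n + N n"
    and lim: "(\<lambda>n. real (vec_space.rank n (R n)) / real n) \<longlonglongrightarrow> 0" "(\<lambda>n. spectral_norm (N n)) \<longlonglongrightarrow> 0"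
    using Y(1) unfolding zero_distributed_def by blast
  have XY: "X n + R n + N n = X n + Y n" for n
    unfolding RN(3) by (rule assoc_add_mat[OF X(1) RN(1,2)])
  \<comment> \<open>Bundling the properties lets one choice of enumerations for each
    \<open>n\<close> satisfy both multiset equations and both count bounds.\<close>
  define good where "good n a b \<longleftrightarrow> eigenvalue_mset (X n) = image_mset a (mset [0..<n]) \<and>
    eigenvalue_mset (X n + Y n) = image_mset b (mset [0..<n]) \<and>
    (\<forall>s\<ge>0. \<forall>c. card {j. j < n \<and> cmod (b j - c) \<le> s}
       \<le> card {k. k < n \<and> cmod (a k - c) \<le> s + spectral_norm (N n)} + vec_space.rank n (R n)) \<and>
    (\<forall>s\<ge>0. \<forall>c. card {j. j < n \<and> cmod (a j - c) \<le> s}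
       \<le> card {k. k < n \<and> cmod (b k - c) \<le> s + spectral_norm (N n)} + vec_space.rank n (R n))" for n a b
  have "\<exists>a b. good n a b" for n
  proof (rule disc_count_zero_distributed[OF X(1,2) _ RN(1,2), of n, unfolded XY, OF Y(2)])
    fix a b
    assume "eigenvalue_mset (X n) = image_mset a (mset [0..<n])"
      "eigenvalue_mset (X n + Y n) = image_mset b (mset [0..<n])"
      "\<forall>s\<ge>0. \<forall>c. card {j. j < n \<and> cmod (b j - c) \<le> s}
         \<le> card {k. k < n \<and> cmod (a k - c) \<le> s + spectral_norm (N n)} + vec_space.rank n (R n)"
      "\<forall>s\<ge>0. \<forall>c. card {j. j < n \<and> cmod (a j - c) \<le> s}
         \<le> card {k. k < n \<and> cmod (b k - c) \<le> s + spectral_norm (N n)} + vec_space.rank n (R n)"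
    then have "good n a b" unfolding good_def by (intro conjI)
    then show ?thesis by (intro exI)
  qed
  then obtain a b where "\<And>n. good n (a n) (b n)" by metis
  note good = this[unfolded good_def]
  have ab: "eigenvalue_mset (X n) = image_mset (a n) (mset [0..<n])"
    "eigenvalue_mset (X n + Y n) = image_mset (b n) (mset [0..<n])" for n
    using good[of n] by simp_all
  have ba: "card {j. j < n \<and> cmod (b n j - c) \<le> s}
       \<le> card {k. k < n \<and> cmod (a n k - c) \<le> s + spectral_norm (N n)} + vec_space.rank n (R n)"
    and ab': "card {j. j < n \<and> cmod (a n j - c) \<le> s}
       \<le> card {k. k < n \<and> cmod (b n k - c) \<le> s + spectral_norm (N n)} + vec_space.rank n (R n)"
    if "0 \<le> s" for n c s
    using good[of n] that by (elim conjE allE[of _ s] allE[of _ c], simp)+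
  show "(\<lambda>n. ((\<Sum>z\<in>#eigenvalue_mset (X n + Y n). F z) - (\<Sum>z\<in>#eigenvalue_mset (X n). F z)) / of_nat n) \<longlonglongrightarrow> 0"
    unfolding ab sum_mset_upt
    using avg_diff_tendsto_0_of_disc_count[OF F schatten_norm_nonneg lim(2,1) ba ab'] by simp
qed

theorem theorem3p2:
  fixes D :: "(real ^ 'k) set"
    and f :: "real ^ 'k \<Rightarrow> complex"
    and X Y :: "nat \<Rightarrow> complex mat"
  assumes "D \<in> sets lebesgue"
    and "0 < emeasure lebesgue D" and "emeasure lebesgue D < \<infinity>"
    and "f \<in> borel_measurable (lebesgue_on D)"
    and "\<And>n. X n \<in> carrier_mat n n"
    and "\<And>n. normal_mat (X n)"
    and "spectral_distribution X D f"
    and "\<And>n. Y n \<in> carrier_mat n n"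
    and "(\<exists>p::ereal. 1 \<le> p \<and> p \<le> 2 \<and> (\<lambda>n. schatten_norm p (Y n)) \<in> o(\<lambda>n. 1))
       \<or> (\<exists>p::ereal. 2 \<le> p \<and> p \<le> \<infinity> \<and>
            (\<lambda>n. schatten_norm p (Y n)) \<in> o(\<lambda>n. real n powr real_of_ereal (2 / p - 1)))
       \<or> (zero_distributed Y \<and> (\<forall>n. normal_mat (X n + Y n)))"
  shows "spectral_distribution (\<lambda>n. X n + Y n) D f"
proof (cases "zero_distributed Y \<and> (\<forall>n. normal_mat (X n + Y n))")
  case True
  then show ?thesis using spectral_distribution_add_zero_distributed[OF assms(5-7)] by blast
next
  \<comment> \<open>One of the two Schatten norm conditions must then hold.\<close>
  case False
  with assms(9) have "(\<lambda>n. frob (Y n)) \<longlonglongrightarrow> 0"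
    by (intro frob_tendsto_0_of_schatten[OF assms(8)]) blast
  then show ?thesis by (rule spectral_distribution_add_frob[OF assms(5-8)])
qed

end
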